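(* Let $r$ be a fixed positive integer. For every $\varepsilon>0$ there exist constants $C=C(r,\varepsilon)>0$ and $p_0=p_0(r,\varepsilon)$ such that the following holds for every prime $p\ge p_0$. Let $\mathcal{M}\subseteq\mathbb{F}_p$ be an arbitrary set of cardinality $M$ with $1\le M\le p^{1/2}$ and let $\mathcal{J}\subseteq\mathbb{F}_p^*$ be an interval of length $N$ with $1\le N\le p^{1-1/r}$. Then for arbitrary complex weights $\boldsymbol\alpha=\{\alpha_m\}_{m\in\mathcal{M}}$, $$\Bigl|\sum_{m\in\mathcal{M}}\sum_{n\in\mathcal{J}}\alpha_m\,\mathcal{K}_p(m,n)\Bigr|\le C\,\|\boldsymbol\alpha\|_\infty\,MN\,p^{1/2+\varepsilon}\left(\frac{p^{1/2}}{M^{1/2}N}+\frac{p^{1/2-1/(4r)}}{N^{1-1/(4r)}}+\frac{p^{1/2-(r-1)/(4r^2)}}{M^{5/(26r)}N^{1-1/(2r)}}\right).$$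
   Context: $\mathbf{e}_p(z)=\exp(2\pi i z/p)$, and the Kloosterman sum is $\mathcal{K}_p(m,n)=\sum_{x\in\mathbb{F}_p^*}\mathbf{e}_p(mx+nx^{-1})$, with $x^{-1}$ the inverse of $x$ in $\mathbb{F}_p^*$. $\mathbb{F}_p$ is identified with $\{0,1,\dots,p-1\}$; an interval in $\mathbb{F}_p$ of length $N$ is the set of residues modulo $p$ of $N$ consecutive integers $N_0+1,\dots,N_0+N$. $\|\boldsymbol\alpha\|_\infty=\max_m|\alpha_m|$. The paper's notation $f\ll p^{o(1)}g$ means: for every $\varepsilon>0$ there is a constant $C_\varepsilon$ with $|f|\le C_\varepsilon p^\varepsilon g$ for all sufficiently large $p$; this has been written out in the claim. *)

theory Defs
  imports
    Complex_Main
    "HOL-Number_Theory.Number_Theory"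
    "HOL-Number_Theory.Modular_Inverse"
begin

text \<open>
  For a prime \<open>p\<close>, the field \<open>F\<^sub>p\<close> is identified with \<open>{0..<p}\<close> and its unit group with
  \<open>{1..<p}\<close>, both as sets of integers.
\<close>

definition e_mod :: "int \<Rightarrow> int \<Rightarrow> complex" where
  "e_mod p z = exp (2 * of_real pi * \<i> * of_int z / of_int p)"

definition kloosterman :: "int \<Rightarrow> int \<Rightarrow> int \<Rightarrow> complex" where
  "kloosterman p m n = (\<Sum>x\<in>{1..<p}. e_mod p (m * x + n * modular_inverse p x))"

text \<open>Intervals are cyclic: the \<open>N\<close> consecutive integers may straddle a multiple of \<open>p\<close>.\<close>

definition is_residue_interval :: "int \<Rightarrow> nat \<Rightarrow> int set \<Rightarrow> bool" where
  "is_residue_interval p N J \<longleftrightarrow> (\<exists>N0::int. J = (\<lambda>k. k mod p) ` {N0 + 1..N0 + int N})"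

text \<open>
  The weights are given by a total function of which only the values on \<open>A\<close> matter;
  the maximum is meaningful for finite nonempty \<open>A\<close>.
\<close>

definition max_norm :: "int set \<Rightarrow> (int \<Rightarrow> complex) \<Rightarrow> real" where
  "max_norm A \<alpha> = Max ((\<lambda>m. cmod (\<alpha> m)) ` A)"

end

theory Submission
  imports
    Defs
    "HOL-Analysis.Complex_Transcendental"
    "HOL-Analysis.Harmonic_Numbers"
    "HOL-Computational_Algebra.Polynomial"
    "HOL-Real_Asymp.Real_Asymp"
begin

text \<open>
  Substituting \<open>y = x\<^sup>-\<^sup>1\<close> turns the sum into \<open>\<Sum>\<^sub>y \<Phi>(y) G(y)\<close> with \<open>G(y) = \<Sum>\<^sub>m \<alpha>\<^sub>m e(m y\<^sup>-\<^sup>1)\<close> and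
  \<open>|\<Phi>(y)| \<le> min(N, p/|y|)\<close>, so it suffices to bound the mean square of \<open>G\<close> over \<open>|y| \<le> X\<close> for dyadic
  \<open>X \<ge> p/N\<close>. Shifting \<open>y\<close> by products \<open>ab\<close> with \<open>b \<le> p\<^bsup>1/r\<^esup>\<close>, \<open>ab \<le> X\<close>, and using Hoelder's inequality
  reduces this to a complete \<open>2r\<close>-th moment and to the number of solutions of
  \<open>(m\<^sub>1-m\<^sub>2)/a = (m\<^sub>3-m\<^sub>4)/a'\<close>, \<open>z/a = z'/a'\<close>. For a ratio \<open>\<rho> = a/a'\<close> of height \<open>T\<close> the pairs \<open>(a,a')\<close> and
  \<open>(z,z')\<close> are points of a planar lattice of determinant \<open>p\<close> with shortest vector about \<open>T\<close>, while the
  pairs of differences number at most \<open>M\<^sup>3\<close> for each \<open>\<rho>\<close> and \<open>M\<^sup>4\<close> altogether. Since the \<open>a\<close> are small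
  integers, this beats what a bound for the multiplicative energy of \<open>\<M> - \<M>\<close> would give, and no
  incidence theorem is needed. The error term \<open>A X\<^sup>2 M\<^bsup>7/2\<^esup> / p\<close> (with \<open>a \<le> A\<close>) in this count is
  admissible once \<open>M\<^bsup>7/26\<^esup> \<le> N\<close>; shorter intervals are covered by Kloosterman's bound \<open>O(p\<^bsup>3/4\<^esup>)\<close> from the fourth moment.
\<close>

section \<open>Additive characters and reciprocals modulo a prime\<close>

text \<open>The exponents come from one comparison. With B near p^(1/r), A near X/B and X at least
  p/N, the coincidence count divided by (A X M^2)^2 / p is about 1/p + 1/(A M^(1/2)) + p/(A X M), up
  to a logarithm and constants. The last term is at most a constant times p^(1/r-1) N^2 / M, the
  middle one a constant times p^(1/r-1) N / M^(1/2). The claim allows p^(1/r-1) N^2 M^(-10/13): the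
  final saving is a 4r-th root, and 10/13 = 4r * 5/(26r). The last term fits at once; the middle one
  fits as soon as M^(10/13-1/2) = M^(7/26) is at most N. The 4r-th root itself arises from a 2r-th
  moment, followed by Cauchy-Schwarz from mean square to mean. The bound p^(3/4) for each
  Kloosterman sum gives the second term of the claim exactly when N^(4r-1) is at most p^(r-1). Past
  that threshold, for r at least 2, N exceeds p^(1/7), whereas M^(7/26) is at most p^(7/52), which
  is smaller. So the two ranges cover everything.\<close>

lemma e_mod_cis: "e_mod p x = cis (2 * pi * of_int x / of_int p)"
  by (simp add: e_mod_def cis_conv_exp mult_ac)

lemma e_mod_add: "e_mod p (x + y) = e_mod p x * e_mod p y"
  by (simp add: e_mod_cis cis_mult ring_distribs add_divide_distrib)

lemma e_mod_0 [simp]: "e_mod p 0 = 1"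
  by (simp add: e_mod_cis)

lemma norm_e_mod [simp]: "cmod (e_mod p x) = 1"
  by (simp add: e_mod_cis)

lemma cnj_e_mod: "cnj (e_mod p x) = e_mod p (- x)"
  by (simp add: e_mod_cis cis_cnj)

lemma e_mod_sum: "e_mod p (\<Sum>i\<in>I. f i) = (\<Prod>i\<in>I. e_mod p (f i))"
  by (induction I rule: infinite_finite_induct) (auto simp: e_mod_add)

lemma e_mod_power: "e_mod p x ^ k = e_mod p (int k * x)"
  by (induction k) (simp_all add: e_mod_add distrib_right)

lemma e_mod_multiple:
  assumes "p \<noteq> 0" shows "e_mod p (p * k) = 1"
proof -
  have "2 * pi * real_of_int (p * k) / real_of_int p = 2 * pi * real_of_int k"
    using assms by simp
  thus ?thesis unfolding e_mod_cis by (simp only: cis_multiple_2pi Ints_of_int)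
qed

lemma cong_int_obtain:
  fixes x y :: int
  assumes "[x = y] (mod p)" obtains k where "x = y + p * k"
  using assms that unfolding cong_iff_lin[of y x] cong_sym_eq[of x y] by blast

lemma e_mod_cong:
  assumes "p \<noteq> 0" "[x = y] (mod p)" shows "e_mod p x = e_mod p y"
proof -
  obtain k where "x = y + p * k"
    using assms(2) by (rule cong_int_obtain)
  thus ?thesis using assms(1) by (simp add: e_mod_add e_mod_multiple)
qed

lemma e_mod_eq_1_iff:
  assumes "p \<noteq> 0" shows "e_mod p x = 1 \<longleftrightarrow> p dvd x"
proof
  assume "e_mod p x = 1"
  hence "exp (\<i> * complex_of_real (2 * pi * real_of_int x / real_of_int p)) = 1"
    by (simp only: e_mod_cis cis_conv_exp)
  then obtain n :: int where "2 * pi * real_of_int x / real_of_int p = of_int (2 * n) * pi"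
    unfolding exp_eq_1 by auto
  hence "real_of_int x = real_of_int (p * n)"
    using assms by (simp add: field_simps)
  hence "x = p * n" by linarith
  thus "p dvd x" by simp
next
  assume "p dvd x"
  thus "e_mod p x = 1" using e_mod_multiple[OF assms] by auto
qed

lemma sum_e_mod_orthogonality:
  assumes "p > 0"
  shows "(\<Sum>s\<in>{0..<p}. e_mod p (s * z)) = (if p dvd z then of_int p else 0)"
proof -
  have "(\<Sum>s\<in>{0..<p}. e_mod p (s * z)) = (\<Sum>i<nat p. e_mod p (int i * z))"
    by (rule sum.reindex_bij_witness[of _ int nat]) (use assms in auto)
  also have "\<dots> = (\<Sum>i<nat p. e_mod p z ^ i)"
    by (simp add: e_mod_power)
  also have "\<dots> = (if p dvd z then of_int p else 0)"
  proof (cases "p dvd z")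
    case True
    hence "e_mod p z = 1" using e_mod_eq_1_iff assms by auto
    thus ?thesis using True assms by simp
  next
    case False
    hence "e_mod p z \<noteq> 1" using e_mod_eq_1_iff assms by auto
    moreover have "e_mod p z ^ nat p = 1"
      using assms e_mod_multiple[of p z] by (simp add: e_mod_power)
    ultimately show ?thesis using False by (simp add: geometric_sum)
  qed
  finally show ?thesis .
qed

text \<open>Opening the square and summing over \<open>u\<close> and \<open>v\<close> leaves only
  the pairs on which both phases agree. This yields the fourth moment of Kloosterman sums, with
  \<open>I\<close> a set of pairs, and through \<open>second_moment_e_mod_1\<close> the 2r-th moment
  of reciprocal sums, with \<open>I\<close> a set of r-tuples.\<close>

lemma second_moment_e_mod:
  fixes \<phi> \<psi> :: "'a \<Rightarrow> int"
  assumes "p > 0" "finite I"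
  shows "(\<Sum>u\<in>{0..<p}. \<Sum>v\<in>{0..<p}. (cmod (\<Sum>i\<in>I. e_mod p (u * \<phi> i + v * \<psi> i)))\<^sup>2)
    = real_of_int p ^ 2 * card {(i, j). i \<in> I \<and> j \<in> I \<and> [\<phi> i = \<phi> j] (mod p) \<and> [\<psi> i = \<psi> j] (mod p)}"
proof -
  define P where "P = {0..<p}"
  let ?S = "{(i, j). i \<in> I \<and> j \<in> I \<and> [\<phi> i = \<phi> j] (mod p) \<and> [\<psi> i = \<psi> j] (mod p)}"
  have sq: "complex_of_real ((cmod (\<Sum>i\<in>I. e_mod p (u * \<phi> i + v * \<psi> i)))\<^sup>2)
     = (\<Sum>z\<in>I\<times>I. e_mod p (u * (\<phi> (fst z) - \<phi> (snd z))) * e_mod p (v * (\<psi> (fst z) - \<psi> (snd z))))" for u v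
  proof -
    have "complex_of_real ((cmod (\<Sum>i\<in>I. e_mod p (u * \<phi> i + v * \<psi> i)))\<^sup>2)
      = (\<Sum>i\<in>I. e_mod p (u * \<phi> i + v * \<psi> i)) * (\<Sum>j\<in>I. e_mod p (- (u * \<phi> j + v * \<psi> j)))"
      by (simp add: complex_norm_square cnj_e_mod del: of_real_power)
    also have "\<dots> = (\<Sum>z\<in>I\<times>I. e_mod p (u * \<phi> (fst z) + v * \<psi> (fst z)) * e_mod p (- (u * \<phi> (snd z) + v * \<psi> (snd z))))"
      by (simp only: sum_product sum.cartesian_product case_prod_unfold)
    also have "\<dots> = (\<Sum>z\<in>I\<times>I. e_mod p (u * (\<phi> (fst z) - \<phi> (snd z))) * e_mod p (v * (\<psi> (fst z) - \<psi> (snd z))))"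
      by (intro sum.cong refl) (simp add: e_mod_add[symmetric] algebra_simps)
    finally show ?thesis .
  qed
  have "complex_of_real (\<Sum>u\<in>P. \<Sum>v\<in>P. (cmod (\<Sum>i\<in>I. e_mod p (u * \<phi> i + v * \<psi> i)))\<^sup>2)
     = (\<Sum>u\<in>P. \<Sum>v\<in>P. \<Sum>z\<in>I\<times>I. e_mod p (u * (\<phi> (fst z) - \<phi> (snd z))) * e_mod p (v * (\<psi> (fst z) - \<psi> (snd z))))"
    by (simp only: of_real_sum sq)
  also have "\<dots> = (\<Sum>u\<in>P. \<Sum>z\<in>I\<times>I. \<Sum>v\<in>P. e_mod p (u * (\<phi> (fst z) - \<phi> (snd z))) * e_mod p (v * (\<psi> (fst z) - \<psi> (snd z))))"
    by (rule sum.cong[OF refl], rule sum.swap)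
  also have "\<dots> = (\<Sum>z\<in>I\<times>I. \<Sum>u\<in>P. \<Sum>v\<in>P. e_mod p (u * (\<phi> (fst z) - \<phi> (snd z))) * e_mod p (v * (\<psi> (fst z) - \<psi> (snd z))))"
    by (rule sum.swap)
  also have "\<dots> = (\<Sum>z\<in>I\<times>I. (\<Sum>u\<in>P. e_mod p (u * (\<phi> (fst z) - \<phi> (snd z)))) * (\<Sum>v\<in>P. e_mod p (v * (\<psi> (fst z) - \<psi> (snd z)))))"
    by (simp only: sum_product)
  also have "\<dots> = (\<Sum>x\<in>I\<times>I. if x \<in> ?S then of_int p ^ 2 else 0)"
    by (intro sum.cong refl)
       (auto simp: sum_e_mod_orthogonality assms P_def cong_iff_dvd_diff power2_eq_square)
  also have "\<dots> = (\<Sum>x\<in>?S. of_int p ^ 2)"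
    using assms by (intro sum.mono_neutral_cong_right) (auto)
  also have "\<dots> = complex_of_real (real_of_int p ^ 2 * card ?S)"
    by simp
  finally show ?thesis unfolding P_def of_real_eq_iff .
qed

lemma second_moment_e_mod_1:
  fixes \<phi> :: "'a \<Rightarrow> int"
  assumes "p > 0" "finite I"
  shows "(\<Sum>u\<in>{0..<p}. (cmod (\<Sum>i\<in>I. e_mod p (u * \<phi> i)))\<^sup>2)
    = real_of_int p * card {(i, j). i \<in> I \<and> j \<in> I \<and> [\<phi> i = \<phi> j] (mod p)}"
  using second_moment_e_mod[OF assms, of \<phi> "\<lambda>_. 0"] assms
  by (simp add: power2_eq_square sum_distrib_left[symmetric] case_prod_unfold)

text \<open>Lagrange's theorem by synthetic division at a root. Being nonzero modulo
  \<open>p\<close> is expressed by one value that \<open>p\<close> does not divide, a property that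
  the quotient inherits at the same point \<open>y\<close>.\<close>

lemma card_roots_mod_prime:
  fixes f :: "int poly"
  assumes "prime p" "\<not> p dvd poly f y"
  shows "card {x\<in>{0..<p}. p dvd poly f x} \<le> degree f"
  using assms(2)
proof (induction "degree f" arbitrary: f rule: less_induct)
  case (less f)
  show ?case
  proof (cases "{x\<in>{0..<p}. p dvd poly f x} = {}")
    case True
    show ?thesis unfolding True by simp
  next
    case False
    then obtain a where a: "a \<in> {0..<p}" "p dvd poly f a" by auto
    define q where "q = synthetic_div f a"
    have f: "poly f x = (x - a) * poly q x + poly f a" for x
      using arg_cong[OF synthetic_div_correct'[of a f], of "\<lambda>f. poly f x"]
      by (simp add: q_def algebra_simps)
    have "degree f \<noteq> 0"
    proof
      assume "degree f = 0"
      then obtain c where "f = [:c:]" by (rule degree_eq_zeroE)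
      thus False using a(2) less.prems by auto
    qed
    hence deg: "degree q < degree f" "degree q + 1 = degree f" by (auto simp: q_def degree_synthetic_div)
    have q: "p dvd poly f x \<longleftrightarrow> p dvd (x - a) \<or> p dvd poly q x" for x
      using a(2) assms(1) by (simp add: f[of x] dvd_add_left_iff prime_dvd_mult_iff)
    have "{x\<in>{0..<p}. p dvd poly f x} \<subseteq> insert a {x\<in>{0..<p}. p dvd poly q x}"
    proof
      fix x assume x: "x \<in> {x\<in>{0..<p}. p dvd poly f x}"
      show "x \<in> insert a {x\<in>{0..<p}. p dvd poly q x}"
      proof (cases "p dvd x - a")
        case True
        hence "x = a" using x a(1) by (auto simp: mod_eq_dvd_iff[symmetric])
        thus ?thesis by simp
      qed (use x q in auto)
    qed
    moreover have fin: "finite {x\<in>{0..<p}. p dvd poly q x}" by (rule finite_subset[of _ "{0..<p}"]) auto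
    ultimately have "card {x\<in>{0..<p}. p dvd poly f x} \<le> card (insert a {x\<in>{0..<p}. p dvd poly q x})"
      by (intro card_mono) simp_all
    also have "\<dots> \<le> Suc (card {x\<in>{0..<p}. p dvd poly q x})"
      by (subst card_insert_if[OF fin]) simp
    also have "\<dots> \<le> Suc (degree q)"
      using less.hyps[OF deg(1)] less.prems q by auto
    finally show ?thesis using deg by simp
  qed
qed

text \<open>\<open>p > 2\<close> makes the exponent of \<open>rcp\<close> positive, so that
  multiples of \<open>p\<close> go to multiples of \<open>p\<close>, and makes \<open>p\<close> odd,
  so that \<open>centred\<close> represents every nonzero residue.\<close>

locale odd_prime =
  fixes p :: int
  assumes prime: "prime p" and gt2: "p > 2"
begin

abbreviation e :: "int \<Rightarrow> complex" where "e \<equiv> e_mod p"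

text \<open>Unlike \<^const>\<open>modular_inverse\<close>, this inverse is exactly multiplicative.\<close>

definition rcp :: "int \<Rightarrow> int" where "rcp x = x ^ nat (p - 2)"

lemma rcp_mult: "rcp (x * y) = rcp x * rcp y"
  by (simp add: rcp_def power_mult_distrib)

lemma rcp_cong: "[x = y] (mod p) \<Longrightarrow> [rcp x = rcp y] (mod p)"
  by (simp add: rcp_def cong_pow)

lemma p_pos: "p > 0" "p \<noteq> 0" using gt2 by auto

lemma rcp_works:
  assumes "\<not> p dvd x" shows "[x * rcp x = 1] (mod p)"
proof -
  obtain q where q: "p = int q" using gt2 by (metis nonneg_int_cases less_imp_le order.strict_trans zero_less_numeral)
  obtain k where k: "x mod p = int k" using gt2 by (metis nonneg_int_cases pos_mod_sign less_trans zero_less_numeral)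
  have "prime q" using prime by (simp add: q)
  have x: "[x = int k] (mod p)"
    by (simp add: k[symmetric] Cong.cong_def)
  have "\<not> q dvd k"
    using assms cong_dvd_iff[OF x] by (simp add: q)
  hence "[k ^ (q - 1) = 1] (mod q)"
    by (rule fermat_theorem[OF \<open>prime q\<close>])
  hence "[int (k ^ (q - 1)) = int 1] (mod int q)"
    by (simp only: cong_int_iff)
  hence "[int k ^ (q - 1) = 1] (mod p)"
    by (simp add: q)
  hence "[x ^ (q - 1) = 1] (mod p)"
    using cong_trans[OF cong_pow[OF x]] by blast
  moreover have "q - 1 = Suc (nat (p - 2))" using gt2 by (simp add: q)
  ultimately show ?thesis by (simp add: rcp_def)
qed

lemma rcp_dvd_iff: "p dvd rcp x \<longleftrightarrow> p dvd x"
proof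
  assume "p dvd rcp x"
  show "p dvd x"
  proof (rule ccontr)
    assume "\<not> p dvd x"
    hence "p dvd 1" using cong_dvd_iff[OF rcp_works[of x]] \<open>p dvd rcp x\<close> by simp
    thus False using gt2 by auto
  qed
next
  assume "p dvd x"
  thus "p dvd rcp x" using gt2 by (simp add: rcp_def dvd_power dvd_trans)
qed

lemma cong_mult_rcancel:
  assumes "\<not> p dvd c" shows "[x * c = y * c] (mod p) \<longleftrightarrow> [x = y] (mod p)"
  using assms prime by (simp add: cong_iff_dvd_diff left_diff_distrib[symmetric] prime_dvd_mult_iff)

lemma cong_mult_rcp_iff:
  assumes "\<not> p dvd c" shows "[x * rcp c = y] (mod p) \<longleftrightarrow> [x = y * c] (mod p)"
proof -
  have "[x * rcp c = y] (mod p) \<longleftrightarrow> [x * rcp c * c = y * c] (mod p)"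
    using cong_mult_rcancel[OF assms] by simp
  also have "[x * rcp c * c = x * 1] (mod p)"
    using cong_mult[OF cong_refl rcp_works[OF assms], of x] by (simp add: mult_ac)
  hence "[x * rcp c * c = y * c] (mod p) \<longleftrightarrow> [x = y * c] (mod p)"
    by (metis cong_sym cong_trans mult.right_neutral)
  finally show ?thesis .
qed

lemma rcp_rcp: "[rcp (rcp x) = x] (mod p)"
proof (cases "p dvd x")
  case True
  hence "p dvd rcp (rcp x)" by (simp add: rcp_dvd_iff)
  with True show ?thesis by (simp add: cong_iff_dvd_diff)
next
  case False
  hence "[1 * rcp (rcp x) = x] (mod p)"
    using rcp_works[OF False] by (subst cong_mult_rcp_iff) (auto simp: rcp_dvd_iff cong_sym)
  thus ?thesis by simp
qed

lemma rcp_inj: "[rcp x = rcp y] (mod p) \<longleftrightarrow> [x = y] (mod p)"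
  using rcp_cong[of x y] rcp_cong[of "rcp x" "rcp y"] rcp_rcp[of x] rcp_rcp[of y]
  by (meson cong_sym cong_trans)

lemma e_cong: "[x = y] (mod p) \<Longrightarrow> e x = e y"
  using e_mod_cong p_pos by auto

lemma modular_inverse_cong_rcp:
  assumes "\<not> p dvd x" shows "[modular_inverse p x = rcp x] (mod p)"
proof -
  have "coprime x p" using prime assms by (simp add: coprime_commute prime_imp_coprime)
  hence "[modular_inverse p x * x = 1] (mod p)" by (rule cong_modular_inverse2)
  moreover have "[rcp x * x = 1] (mod p)" using rcp_works[OF assms] by (simp add: mult.commute)
  ultimately show ?thesis using cong_mult_rcancel[OF assms] by (meson cong_sym cong_trans)
qed

lemma not_dvd_unit: "x \<in> {1..<p} \<Longrightarrow> \<not> p dvd x"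
  using zdvd_not_zless by auto

lemma kloosterman_rcp: "kloosterman p m n = (\<Sum>x\<in>{1..<p}. e (m * x + n * rcp x))"
  unfolding kloosterman_def
  by (intro sum.cong refl e_cong cong_add cong_mult modular_inverse_cong_rcp not_dvd_unit) auto

end

section \<open>Kloosterman's fourth moment bound\<close>

lemma power_sum_le_card_mult_sum_power:
  fixes f :: "'a \<Rightarrow> real"
  assumes "\<And>i. i \<in> I \<Longrightarrow> f i \<ge> 0" and "n \<ge> 1"
  shows "(\<Sum>i\<in>I. f i) ^ n \<le> real (card I) ^ (n - 1) * (\<Sum>i\<in>I. f i ^ n)"
proof (cases "finite I \<and> I \<noteq> {}")
  case True
  have "convex_on {0::real..} (\<lambda>x. x ^ n)"
    using convex_power_odd[of n] convex_on_subset[OF convex_power_even[of n]] by (cases "even n") auto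
  hence "(\<Sum>i\<in>I. (1 / real (card I)) *\<^sub>R f i) ^ n \<le> (\<Sum>i\<in>I. (1 / real (card I)) * f i ^ n)"
    using True assms by (intro convex_on_sum) auto
  hence "((\<Sum>i\<in>I. f i) / real (card I)) ^ n \<le> (\<Sum>i\<in>I. f i ^ n) / real (card I)"
    by (simp add: sum_divide_distrib)
  moreover obtain k where n: "n = Suc k" using assms(2) by (cases n) auto
  have "real (card I) > 0" using True by (simp add: card_gt_0_iff)
  ultimately show ?thesis
    by (simp add: n power_divide field_simps)
next
  case False
  thus ?thesis using assms(2) by (auto simp: power_0_left)
qed

lemma sum_comp_eq_sum_card_fibre:
  fixes f :: "'b \<Rightarrow> 'c :: semiring_1"
  assumes "finite \<Omega>" "finite S" "\<theta> ` \<Omega> \<subseteq> S"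
  shows "(\<Sum>\<omega>\<in>\<Omega>. f (\<theta> \<omega>)) = (\<Sum>s\<in>S. of_nat (card {\<omega>\<in>\<Omega>. \<theta> \<omega> = s}) * f s)"
proof -
  have "(\<Sum>\<omega>\<in>\<Omega>. f (\<theta> \<omega>)) = (\<Sum>s\<in>S. \<Sum>\<omega>\<in>{\<omega>\<in>\<Omega>. \<theta> \<omega> = s}. f (\<theta> \<omega>))"
    by (rule sum.group[OF assms, symmetric])
  also have "\<dots> = (\<Sum>s\<in>S. \<Sum>\<omega>\<in>{\<omega>\<in>\<Omega>. \<theta> \<omega> = s}. f s)"
    by (intro sum.cong) auto
  finally show ?thesis by simp
qed

text \<open>Grouping by the value of \<open>\<theta>\<close> and applying Cauchy-Schwarz separates
  the multiplicities, whose squares add up to the number of coincidences, from a sum over all of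
  \<open>S\<close> in which \<open>\<theta>\<close> no longer appears.\<close>

lemma sum_comp_squared_le:
  fixes f :: "'b \<Rightarrow> real"
  assumes "finite \<Omega>" "finite S" "\<theta> ` \<Omega> \<subseteq> S"
  shows "(\<Sum>\<omega>\<in>\<Omega>. f (\<theta> \<omega>))\<^sup>2 \<le>
    real (card {(\<omega>, \<omega>'). \<omega> \<in> \<Omega> \<and> \<omega>' \<in> \<Omega> \<and> \<theta> \<omega> = \<theta> \<omega>'}) * (\<Sum>s\<in>S. (f s)\<^sup>2)"
proof -
  define N where "N s = card {\<omega>\<in>\<Omega>. \<theta> \<omega> = s}" for s
  have "{(\<omega>, \<omega>'). \<omega> \<in> \<Omega> \<and> \<omega>' \<in> \<Omega> \<and> \<theta> \<omega> = \<theta> \<omega>'} = (SIGMA \<omega>:\<Omega>. {\<omega>'\<in>\<Omega>. \<theta> \<omega>' = \<theta> \<omega>})"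
    by auto
  hence "real (card {(\<omega>, \<omega>'). \<omega> \<in> \<Omega> \<and> \<omega>' \<in> \<Omega> \<and> \<theta> \<omega> = \<theta> \<omega>'}) = (\<Sum>\<omega>\<in>\<Omega>. real (N (\<theta> \<omega>)))"
    using assms(1) by (simp add: N_def)
  also have "\<dots> = (\<Sum>s\<in>S. (real (N s))\<^sup>2)"
    by (subst sum_comp_eq_sum_card_fibre[OF assms]) (simp add: N_def power2_eq_square)
  finally have card: "real (card {(\<omega>, \<omega>'). \<omega> \<in> \<Omega> \<and> \<omega>' \<in> \<Omega> \<and> \<theta> \<omega> = \<theta> \<omega>'}) = (\<Sum>s\<in>S. (real (N s))\<^sup>2)" .
  have "(\<Sum>\<omega>\<in>\<Omega>. f (\<theta> \<omega>)) = (\<Sum>s\<in>S. real (N s) * f s)"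
    unfolding N_def by (rule sum_comp_eq_sum_card_fibre[OF assms])
  thus ?thesis
    using Cauchy_Schwarz_ineq_sum[of "\<lambda>s. real (N s)" f S] card by simp
qed

context odd_prime
begin

lemma kloosterman_cong:
  assumes "[m = m'] (mod p)" "[n = n'] (mod p)"
  shows "kloosterman p m n = kloosterman p m' n'"
  unfolding kloosterman_rcp using assms
  by (intro sum.cong refl e_cong cong_add cong_mult) auto

lemma mult_mod_bij_betw:
  assumes "\<not> p dvd a"
  shows "bij_betw (\<lambda>x. a * x mod p) {1..<p} {1..<p}"
proof -
  have *: "inj_on (\<lambda>x. a * x mod p) {1..<p}"
  proof
    fix x y assume xy: "x \<in> {1..<p}" "y \<in> {1..<p}" "a * x mod p = a * y mod p"
    hence "[x * a = y * a] (mod p)" by (simp add: Cong.cong_def mult.commute)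
    hence "[x = y] (mod p)" using cong_mult_rcancel[OF assms] by simp
    thus "x = y" using xy by (auto simp: Cong.cong_def)
  qed
  have "a * x mod p \<in> {1..<p}" if "x \<in> {1..<p}" for x
  proof -
    have "\<not> p dvd a * x" using assms not_dvd_unit[OF that] prime by (simp add: prime_dvd_mult_iff)
    hence "a * x mod p \<noteq> 0" by (simp add: dvd_eq_mod_eq_0)
    moreover have "a * x mod p \<ge> 0" "a * x mod p < p" using p_pos by simp_all
    ultimately show ?thesis by auto
  qed
  hence "(\<lambda>x. a * x mod p) ` {1..<p} \<subseteq> {1..<p}" by blast
  hence "(\<lambda>x. a * x mod p) ` {1..<p} = {1..<p}"
    using endo_inj_surj[of "{1..<p}" "\<lambda>x. a * x mod p"] * by simp
  thus ?thesis using * by (simp add: bij_betw_def)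
qed

lemma kloosterman_scale:
  assumes "\<not> p dvd a"
  shows "kloosterman p (a * m) (rcp a * n) = kloosterman p m n"
proof -
  have "kloosterman p m n = (\<Sum>x\<in>{1..<p}. e (m * (a * x mod p) + n * rcp (a * x mod p)))"
    unfolding kloosterman_rcp by (rule sum.reindex_bij_betw[OF mult_mod_bij_betw[OF assms], symmetric])
  also have "\<dots> = (\<Sum>x\<in>{1..<p}. e (m * (a * x) + n * rcp (a * x)))"
    by (intro sum.cong refl e_cong cong_add cong_mult rcp_cong) (auto simp: Cong.cong_def)
  also have "\<dots> = kloosterman p (a * m) (rcp a * n)"
    unfolding kloosterman_rcp by (simp add: rcp_mult mult_ac)
  finally show ?thesis by simp
qed

text \<open>Clearing denominators gives (x3 + x4)(x3 x4 - x1 x2) = 0 modulo \<open>p\<close>. Either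
  both sums vanish, or the two pairs share sum and product and are the roots of one
  quadratic.\<close>

lemma two_sums_coincide:
  assumes x: "x1 \<in> {1..<p}" "x2 \<in> {1..<p}" "x3 \<in> {1..<p}" "x4 \<in> {1..<p}"
    and s: "[x1 + x2 = x3 + x4] (mod p)" and t: "[rcp x1 + rcp x2 = rcp x3 + rcp x4] (mod p)"
  shows "x1 = x3 \<and> x2 = x4 \<or> x1 = x4 \<and> x2 = x3 \<or> x2 = p - x1 \<and> x4 = p - x3"
proof -
  have eqI: "u = v" if "p dvd u - v" "u \<in> {1..<p}" "v \<in> {1..<p}" for u v
    using that by (auto simp: mod_eq_dvd_iff[symmetric])
  have eqI': "v = p - u" if uv: "p dvd u + v" "u \<in> {1..<p}" "v \<in> {1..<p}" for u v
  proof -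
    obtain k where k: "u + v = p * k" using uv(1) by (elim dvdE)
    have "p * 0 < u + v" "u + v < p * 2" using uv(2,3) by auto
    hence "p * 0 < p * k" "p * k < p * 2" by (simp_all only: k)
    hence "0 < k" "k < 2" using p_pos(1) by (simp_all only: mult_less_cancel_left_pos)
    hence "k = 1" by simp
    thus ?thesis using k by simp
  qed
  obtain k1 where k1: "x1 * rcp x1 = 1 + p * k1" by (rule cong_int_obtain[OF rcp_works[OF not_dvd_unit[OF x(1)]]])
  obtain k2 where k2: "x2 * rcp x2 = 1 + p * k2" by (rule cong_int_obtain[OF rcp_works[OF not_dvd_unit[OF x(2)]]])
  obtain k3 where k3: "x3 * rcp x3 = 1 + p * k3" by (rule cong_int_obtain[OF rcp_works[OF not_dvd_unit[OF x(3)]]])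
  obtain k4 where k4: "x4 * rcp x4 = 1 + p * k4" by (rule cong_int_obtain[OF rcp_works[OF not_dvd_unit[OF x(4)]]])
  obtain k where k': "rcp x1 + rcp x2 = rcp x3 + rcp x4 + p * k" by (rule cong_int_obtain[OF t])
  obtain l where l: "x1 + x2 = x3 + x4 + p * l" by (rule cong_int_obtain[OF s])
  \<comment> \<open>An identity over the integers: each relation for a single reciprocal enters with
    the product of the other three variables as multiplier.\<close>
  have "(x1 + x2) * (x3 * x4) - (x3 + x4) * (x1 * x2)
    = x1*x2*x3*x4 * (rcp x1 + rcp x2 - (rcp x3 + rcp x4)) - x2*x3*x4 * (x1 * rcp x1 - 1)
      - x1*x3*x4 * (x2 * rcp x2 - 1) + x1*x2*x4 * (x3 * rcp x3 - 1) + x1*x2*x3 * (x4 * rcp x4 - 1)"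
    by (simp add: algebra_simps)
  also have "\<dots> = p * (x1*x2*x3*x4*k - x2*x3*x4*k1 - x1*x3*x4*k2 + x1*x2*x4*k3 + x1*x2*x3*k4)"
    unfolding k1 k2 k3 k4 k' by (simp add: algebra_simps)
  finally have "p dvd (x1 + x2) * (x3 * x4) - (x3 + x4) * (x1 * x2)" by simp
  moreover have "(x1 + x2) * (x3 * x4) - (x3 + x4) * (x1 * x2)
      = (x3 + x4) * (x3 * x4 - x1 * x2) + p * (l * (x3 * x4))"
    unfolding l by (simp add: algebra_simps)
  ultimately have "p dvd (x3 + x4) * (x3 * x4 - x1 * x2)"
    by (metis dvd_add_left_iff dvd_triv_left)
  hence "p dvd x3 + x4 \<or> p dvd x3 * x4 - x1 * x2" using prime by (simp add: prime_dvd_mult_iff)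
  thus ?thesis
  proof
    assume *: "p dvd x3 + x4"
    hence "p dvd x1 + x2" by (simp add: l)
    thus ?thesis using * eqI' x by blast
  next
    assume "p dvd x3 * x4 - x1 * x2"
    moreover have "(x1 - x3) * (x1 - x4) = (x3 * x4 - x1 * x2) + p * (x1 * l)"
    proof -
      have "x3 + x4 = x1 + x2 - p * l" using l by simp
      hence "x1 * (x3 + x4) = x1 * (x1 + x2 - p * l)" by simp
      thus ?thesis by (simp add: algebra_simps)
    qed
    ultimately have "p dvd (x1 - x3) * (x1 - x4)" by simp
    hence "p dvd x1 - x3 \<or> p dvd x1 - x4" using prime by (simp add: prime_dvd_mult_iff)
    hence "x1 = x3 \<or> x1 = x4" using eqI x by blast
    moreover have "p dvd x2 - x4" if "x1 = x3" using l that by simp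
    moreover have "p dvd x2 - x3" if "x1 = x4" using l that by simp
    ultimately show ?thesis using eqI x by blast
  qed
qed

text \<open>The square of a Kloosterman sum is an exponential sum over pairs, so this is a second
  moment. The factor 3 counts the families of solutions left by \<open>two_sums_coincide\<close>,
  each parametrised by two units.\<close>

lemma kloosterman_fourth_moment:
  "(\<Sum>u\<in>{0..<p}. \<Sum>v\<in>{0..<p}. cmod (kloosterman p u v) ^ 4) \<le> 3 * real_of_int p ^ 2 * real_of_int (p - 1) ^ 2"
proof -
  define U where "U = {1..<p}"
  define Q where "Q = {(i, j). i \<in> U \<times> U \<and> j \<in> U \<times> U \<and> [fst i + snd i = fst j + snd j] (mod p)
     \<and> [rcp (fst i) + rcp (snd i) = rcp (fst j) + rcp (snd j)] (mod p)}"
  have fin: "finite (U \<times> U)" by (simp add: U_def)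
  have sq: "(kloosterman p u v)\<^sup>2 = (\<Sum>i\<in>U\<times>U. e (u * (fst i + snd i) + v * (rcp (fst i) + rcp (snd i))))" for u v
    unfolding kloosterman_rcp power2_eq_square sum_product sum.cartesian_product U_def[symmetric]
    by (intro sum.cong refl) (auto simp: e_mod_add[symmetric] algebra_simps)
  have "cmod (kloosterman p u v) ^ 4 = (cmod ((kloosterman p u v)\<^sup>2))\<^sup>2" for u v
    by (simp add: norm_power)
  hence eq: "(\<Sum>u\<in>{0..<p}. \<Sum>v\<in>{0..<p}. cmod (kloosterman p u v) ^ 4) = real_of_int p ^ 2 * card Q"
    unfolding sq Q_def using second_moment_e_mod[OF p_pos(1) fin] by simp
  have "card Q \<le> 3 * card (U \<times> U)"
  proof -
    let ?f = "\<lambda>(x, y). ((x, y), (x, y))" and ?g = "\<lambda>(x, y). ((x, y), (y, x))"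
    let ?h = "\<lambda>(x, y). ((x, p - x), (y, p - y))"
    have "Q \<subseteq> ?f ` (U \<times> U) \<union> ?g ` (U \<times> U) \<union> ?h ` (U \<times> U)"
    proof (rule subsetI)
      fix z assume "z \<in> Q"
      then obtain x1 x2 x3 x4 where z: "z = ((x1, x2), (x3, x4))" and U: "x1 \<in> U" "x2 \<in> U" "x3 \<in> U" "x4 \<in> U"
        and "[x1 + x2 = x3 + x4] (mod p)" "[rcp x1 + rcp x2 = rcp x3 + rcp x4] (mod p)"
        by (auto simp: Q_def)
      hence "x1 = x3 \<and> x2 = x4 \<or> x1 = x4 \<and> x2 = x3 \<or> x2 = p - x1 \<and> x4 = p - x3"
        unfolding U_def by (intro two_sums_coincide)
      thus "z \<in> ?f ` (U \<times> U) \<union> ?g ` (U \<times> U) \<union> ?h ` (U \<times> U)"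
        using U by (auto simp: z)
    qed
    hence "card Q \<le> card (?f ` (U \<times> U) \<union> ?g ` (U \<times> U) \<union> ?h ` (U \<times> U))"
      using fin by (intro card_mono) auto
    also have "\<dots> \<le> card (?f ` (U \<times> U)) + card (?g ` (U \<times> U)) + card (?h ` (U \<times> U))"
      by (meson card_Un_le add_le_mono order_trans order_refl)
    also have "\<dots> \<le> card (U \<times> U) + card (U \<times> U) + card (U \<times> U)"
      using fin by (intro add_mono card_image_le)
    finally show ?thesis by simp
  qed
  hence "real (card Q) \<le> real (3 * card (U \<times> U))" by (rule of_nat_mono)
  hence "real (card Q) \<le> 3 * real_of_int (p - 1) ^ 2"
    using gt2 by (simp add: U_def power2_eq_square)
  hence "real_of_int p ^ 2 * card Q \<le> real_of_int p ^ 2 * (3 * real_of_int (p - 1) ^ 2)"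
    by (rule mult_left_mono) simp
  thus ?thesis unfolding eq by (simp add: mult_ac)
qed

text \<open>The \<open>p - 1\<close> pairs (am, n/a) all give the value at (m, n), and they are
  distinct because \<open>p\<close> does not divide \<open>n\<close>. Hence the fourth power of this
  one value is at most the full fourth moment divided by \<open>p - 1\<close>.\<close>

lemma norm_kloosterman_le:
  assumes "\<not> p dvd n"
  shows "cmod (kloosterman p m n) ^ 4 \<le> 3 * real_of_int p ^ 3"
proof -
  define h where "h a = (a * m mod p, rcp a * n mod p)" for a
  have "inj_on h {1..<p}"
  proof
    fix a b assume ab: "a \<in> {1..<p}" "b \<in> {1..<p}" "h a = h b"
    hence "[rcp a * n = rcp b * n] (mod p)" by (simp add: h_def Cong.cong_def)
    hence "[a = b] (mod p)" using cong_mult_rcancel[OF assms] rcp_inj by simp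
    thus "a = b" using ab by (auto simp: Cong.cong_def)
  qed
  moreover have "h ` {1..<p} \<subseteq> {0..<p} \<times> {0..<p}" using p_pos by (auto simp: h_def)
  ultimately have "(\<Sum>a\<in>{1..<p}. cmod (kloosterman p (fst (h a)) (snd (h a))) ^ 4)
       \<le> (\<Sum>z\<in>{0..<p}\<times>{0..<p}. cmod (kloosterman p (fst z) (snd z)) ^ 4)"
    by (subst sum.reindex[symmetric, where g = "\<lambda>z. cmod (kloosterman p (fst z) (snd z)) ^ 4", simplified comp_def])
       (auto intro!: sum_mono2)
  also have "\<dots> \<le> 3 * real_of_int p ^ 2 * real_of_int (p - 1) ^ 2"
    using kloosterman_fourth_moment by (simp only: sum.cartesian_product case_prod_unfold)
  also have "kloosterman p (fst (h a)) (snd (h a)) = kloosterman p m n" if "a \<in> {1..<p}" for a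
  proof -
    have "kloosterman p (fst (h a)) (snd (h a)) = kloosterman p (a * m) (rcp a * n)"
      by (rule kloosterman_cong) (auto simp: h_def Cong.cong_def)
    thus ?thesis using kloosterman_scale[OF not_dvd_unit[OF that]] by simp
  qed
  hence "(\<Sum>a\<in>{1..<p}. cmod (kloosterman p (fst (h a)) (snd (h a))) ^ 4) = real_of_int (p - 1) * cmod (kloosterman p m n) ^ 4"
    using gt2 by simp
  finally have "real_of_int (p - 1) * cmod (kloosterman p m n) ^ 4 \<le> real_of_int (p - 1) * (3 * real_of_int p ^ 2 * real_of_int (p - 1))"
    by (simp add: power2_eq_square mult_ac)
  hence "cmod (kloosterman p m n) ^ 4 \<le> 3 * real_of_int p ^ 2 * real_of_int (p - 1)"
    using gt2 by (subst (asm) mult_le_cancel_left_pos) auto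
  also have "\<dots> \<le> 3 * real_of_int p ^ 2 * real_of_int p"
    using gt2 by (intro mult_left_mono) auto
  finally show ?thesis by (simp add: power2_eq_square power3_eq_cube mult_ac)
qed

end

section \<open>Moments of reciprocal sums\<close>

lemma sum_card_filter_swap:
  assumes "finite X" "finite Y"
  shows "(\<Sum>x\<in>X. card {y\<in>Y. R x y}) = (\<Sum>y\<in>Y. card {x\<in>X. R x y})"
proof -
  have "(\<Sum>x\<in>X. card {y\<in>Y. R x y}) = (\<Sum>x\<in>X. \<Sum>y\<in>Y. if R x y then 1 else 0)"
    using assms by (simp add: sum.If_cases Int_def)
  also have "\<dots> = (\<Sum>y\<in>Y. \<Sum>x\<in>X. if R x y then 1 else 0)"
    by (rule sum.swap)
  finally show ?thesis using assms by (simp add: sum.If_cases Int_def)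
qed

context odd_prime
begin

text \<open>Collecting equal shifts turns the difference of the two sums into a sum of c(b)/(t+b),
  whose numerator is \<open>F\<close>. At -b0 only the term of b0 survives, with value c(b0) times
  the product of the b' - b0; all factors are nonzero and smaller than \<open>p\<close> in absolute
  value, so \<open>F\<close> does not vanish modulo \<open>p\<close>. Its at most 2r roots and the
  at most 2r poles t = -b make up 4r.\<close>

lemma card_reciprocal_sums_coincide:
  fixes g h :: "nat \<Rightarrow> int"
  assumes g: "g \<in> {..<r} \<rightarrow> {1..B}" and h: "h \<in> {..<r} \<rightarrow> {1..B}" and B: "B < p" and r: "int r < p"
    and ne: "card {i\<in>{..<r}. g i = b0} \<noteq> card {i\<in>{..<r}. h i = b0}"
  shows "card {t\<in>{0..<p}. [(\<Sum>i<r. rcp (t + g i)) = (\<Sum>i<r. rcp (t + h i))] (mod p)} \<le> 4 * r"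
proof -
  define D where "D = g ` {..<r} \<union> h ` {..<r}"
  define c where "c b = int (card {i\<in>{..<r}. g i = b}) - int (card {i\<in>{..<r}. h i = b})" for b
  define F where "F = (\<Sum>b\<in>D. [:c b:] * (\<Prod>b'\<in>D-{b}. [:b', 1:]))"
  have finD: "finite D" by (simp add: D_def)
  have "card D \<le> card (g ` {..<r}) + card (h ` {..<r})" unfolding D_def by (rule card_Un_le)
  also have "\<dots> \<le> r + r"
    by (intro add_mono) (auto intro: order_trans[OF card_image_le])
  finally have cardD: "card D \<le> 2 * r" by simp
  have D: "D \<subseteq> {1..B}" using g h by (auto simp: D_def)
  have b0: "b0 \<in> D"
  proof (rule ccontr)
    assume "b0 \<notin> D"
    hence none: "{i\<in>{..<r}. g i = b0} = {}" "{i\<in>{..<r}. h i = b0} = {}" by (auto simp: D_def)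
    show False using ne unfolding none by simp
  qed
  have poly_F: "poly F t = (\<Sum>b\<in>D. c b * (\<Prod>b'\<in>D-{b}. t + b'))" for t
    by (simp add: F_def poly_sum poly_prod add.commute)
  have "degree F \<le> card D"
    unfolding F_def
  proof (rule degree_sum_le[OF finD])
    fix b assume "b \<in> D"
    have "degree ([:c b:] * (\<Prod>b'\<in>D-{b}. [:b', 1:])) \<le> degree (\<Prod>b'\<in>D-{b}. [:b', 1:])"
      by (rule order_trans[OF degree_mult_le]) simp
    also have "\<dots> \<le> (\<Sum>b'\<in>D-{b}. degree [:b', 1:])"
      using degree_prod_sum_le[of "D - {b}" "\<lambda>b'. [:b', 1:]"] finD by (simp add: comp_def)
    also have "\<dots> \<le> card D" using finD by (simp add: card_Diff1_le)
    finally show "degree ([:c b:] * (\<Prod>b'\<in>D-{b}. [:b', 1:])) \<le> card D" .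
  qed
  hence deg: "degree F \<le> 2 * r" using cardD by simp
  have small: "\<not> p dvd z" if "z \<noteq> 0" "\<bar>z\<bar> < p" for z
    using that dvd_imp_le_int[of z p] by linarith
  have nz: "\<not> p dvd poly F (- b0)"
  proof -
    have "poly F (- b0) = c b0 * (\<Prod>b'\<in>D-{b0}. - b0 + b')"
    proof -
      have "poly F (- b0) = (\<Sum>b\<in>{b0}. c b * (\<Prod>b'\<in>D-{b}. - b0 + b'))"
        unfolding poly_F
      proof (rule sum.mono_neutral_right)
        show "\<forall>i\<in>D - {b0}. c i * (\<Prod>b'\<in>D - {i}. - b0 + b') = 0"
        proof
          fix i assume "i \<in> D - {b0}"
          hence "\<exists>a\<in>D - {i}. - b0 + a = 0" using b0 by auto
          thus "c i * (\<Prod>b'\<in>D - {i}. - b0 + b') = 0" using finD by (simp add: prod_zero)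
        qed
      qed (use finD b0 in auto)
      thus ?thesis by simp
    qed
    moreover have "\<not> p dvd c b0"
    proof (rule small)
      show "c b0 \<noteq> 0" using ne by (simp add: c_def)
      have "card {i\<in>{..<r}. g i = b0} \<le> card {..<r}" "card {i\<in>{..<r}. h i = b0} \<le> card {..<r}"
        by (intro card_mono; auto)+
      thus "\<bar>c b0\<bar> < p" using r by (auto simp: c_def)
    qed
    moreover have "\<not> p dvd - b0 + b'" if "b' \<in> D - {b0}" for b'
    proof (rule small)
      have "b' \<in> {1..B}" "b0 \<in> {1..B}" using that D b0 by auto
      thus "\<bar>- b0 + b'\<bar> < p" using B by auto
    qed (use that in auto)
    hence "\<not> p dvd (\<Prod>b'\<in>D-{b0}. - b0 + b')"
      using prime finD by (subst prime_dvd_prod_iff) auto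
    ultimately show ?thesis using prime by (simp add: prime_dvd_mult_iff)
  qed
  let ?Z = "{t\<in>{0..<p}. [(\<Sum>i<r. rcp (t + g i)) = (\<Sum>i<r. rcp (t + h i))] (mod p)}"
  have "?Z \<subseteq> {t\<in>{0..<p}. p dvd poly F t} \<union> (\<lambda>b. (- b) mod p) ` D"
  proof
    fix t assume t: "t \<in> ?Z"
    show "t \<in> {t\<in>{0..<p}. p dvd poly F t} \<union> (\<lambda>b. (- b) mod p) ` D"
    proof (cases "\<exists>b\<in>D. p dvd t + b")
      case True
      then obtain b where b: "b \<in> D" "p dvd t + b" by auto
      hence "t mod p = (- b) mod p" by (simp add: mod_eq_dvd_iff)
      hence "t = (- b) mod p" using t by simp
      thus ?thesis using b by blast
    next
      case False
      have *: "(\<Sum>i<r. rcp (t + u i)) = (\<Sum>b\<in>D. int (card {i\<in>{..<r}. u i = b}) * rcp (t + b))"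
        if "u ` {..<r} \<subseteq> D" for u
        using sum_comp_eq_sum_card_fibre[OF _ finD that, of "\<lambda>b. rcp (t + b)"] by simp
      have "p dvd (\<Sum>i<r. rcp (t + g i)) - (\<Sum>i<r. rcp (t + h i))"
        using t by (simp add: cong_iff_dvd_diff)
      also have "(\<Sum>i<r. rcp (t + g i)) - (\<Sum>i<r. rcp (t + h i)) = (\<Sum>b\<in>D. c b * rcp (t + b))"
        using *[of g] *[of h] by (simp add: D_def c_def sum_subtractf left_diff_distrib)
      finally have dvd: "p dvd (\<Sum>b\<in>D. c b * rcp (t + b)) * (\<Prod>b\<in>D. t + b)"
        by (rule dvd_mult2)
      have "[(\<Sum>b\<in>D. c b * rcp (t + b)) * (\<Prod>b\<in>D. t + b) = poly F t] (mod p)"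
        unfolding sum_distrib_right poly_F
      proof (rule cong_sum)
        fix b assume b: "b \<in> D"
        have "c b * rcp (t + b) * (\<Prod>b\<in>D. t + b) = c b * (\<Prod>b\<in>D-{b}. t + b) * ((t + b) * rcp (t + b))"
          using finD b by (simp add: prod.remove mult_ac)
        also have "[\<dots> = c b * (\<Prod>b\<in>D-{b}. t + b) * 1] (mod p)"
          using False b by (intro cong_mult cong_refl rcp_works) auto
        finally show "[c b * rcp (t + b) * (\<Prod>b\<in>D. t + b) = c b * (\<Prod>b'\<in>D-{b}. t + b')] (mod p)"
          by simp
      qed
      hence "p dvd poly F t" using dvd cong_dvd_iff by blast
      thus ?thesis using t by simp
    qed
  qed
  hence "card ?Z \<le> card ({t\<in>{0..<p}. p dvd poly F t} \<union> (\<lambda>b. (- b) mod p) ` D)"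
    using finD by (intro card_mono finite_UnI finite_imageI) (auto intro: finite_subset[of _ "{0..<p}"])
  also have "\<dots> \<le> card {t\<in>{0..<p}. p dvd poly F t} + card ((\<lambda>b. (- b) mod p) ` D)"
    by (rule card_Un_le)
  also have "\<dots> \<le> degree F + card D"
    by (intro add_mono card_roots_mod_prime[OF prime nz] card_image_le finD)
  also have "\<dots> \<le> 4 * r" using deg cardD by simp
  finally show ?thesis .
qed

text \<open>The sum over \<open>s\<close> turns the 2r-th power into a count of pairs of r-tuples
  with equal reciprocal sums at \<open>t\<close>. Pairs equal as multisets (\<open>bad\<close>) are
  charged all \<open>p\<close> values of \<open>t\<close>, any other pair at most 4r. The two
  contributions balance when B^r has the size of \<open>p\<close>.\<close>

lemma reciprocal_moment:
  fixes B r :: nat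
  assumes B: "int B < p" and r: "int r < p"
  shows "(\<Sum>s\<in>{0..<p}. \<Sum>t\<in>{0..<p}. cmod (\<Sum>b\<in>{1..int B}. e (s * rcp (t + b))) ^ (2 * r))
    \<le> real_of_int p * (real_of_int p * real B ^ r * real r ^ r + 4 * real r * real B ^ (2 * r))"
proof -
  define \<Gamma> where "\<Gamma> = PiE {..<r} (\<lambda>_. {1..int B})"
  define C where "C t z \<longleftrightarrow> [(\<Sum>i<r. rcp (t + fst z i)) = (\<Sum>i<r. rcp (t + snd z i))] (mod p)"
    for t and z :: "(nat \<Rightarrow> int) \<times> (nat \<Rightarrow> int)"
  define bad where "bad z \<longleftrightarrow> (\<forall>b. card {i\<in>{..<r}. fst z i = b} = card {i\<in>{..<r}. snd z i = b})"
    for z :: "(nat \<Rightarrow> int) \<times> (nat \<Rightarrow> int)"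
  have fin: "finite \<Gamma>" unfolding \<Gamma>_def by (intro finite_PiE) auto
  have card\<Gamma>: "card \<Gamma> = B ^ r" by (simp add: \<Gamma>_def card_PiE)
  have pow: "(\<Sum>b\<in>{1..int B}. e (s * rcp (t + b))) ^ r = (\<Sum>g\<in>\<Gamma>. e (s * (\<Sum>i<r. rcp (t + g i))))" for s t
  proof -
    have "(\<Sum>b\<in>{1..int B}. e (s * rcp (t + b))) ^ r = (\<Prod>i<r. \<Sum>b\<in>{1..int B}. e (s * rcp (t + b)))"
      by simp
    also have "\<dots> = (\<Sum>g\<in>\<Gamma>. \<Prod>i<r. e (s * rcp (t + g i)))"
      unfolding \<Gamma>_def by (rule prod_sum_PiE) auto
    finally show ?thesis by (simp add: e_mod_sum[symmetric] sum_distrib_left)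
  qed
  have "(\<Sum>s\<in>{0..<p}. cmod (\<Sum>b\<in>{1..int B}. e (s * rcp (t + b))) ^ (2 * r)) = 
      real_of_int p * card {z \<in> \<Gamma> \<times> \<Gamma>. C t z}" for t
  proof -
    have "(\<Sum>s\<in>{0..<p}. cmod (\<Sum>b\<in>{1..int B}. e (s * rcp (t + b))) ^ (2 * r))
      = (\<Sum>s\<in>{0..<p}. (cmod (\<Sum>g\<in>\<Gamma>. e (s * (\<Sum>i<r. rcp (t + g i)))))\<^sup>2)"
      unfolding pow[symmetric] by (simp add: norm_power power_mult[symmetric] mult.commute)
    also have "\<dots> = real_of_int p * card {(g, h). g \<in> \<Gamma> \<and> h \<in> \<Gamma> \<and>
        [(\<Sum>i<r. rcp (t + g i)) = (\<Sum>i<r. rcp (t + h i))] (mod p)}"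
      by (rule second_moment_e_mod_1[OF p_pos(1) fin])
    also have "{(g, h). g \<in> \<Gamma> \<and> h \<in> \<Gamma> \<and>
        [(\<Sum>i<r. rcp (t + g i)) = (\<Sum>i<r. rcp (t + h i))] (mod p)} = {z \<in> \<Gamma> \<times> \<Gamma>. C t z}"
      by (auto simp: C_def)
    finally show ?thesis .
  qed
  note inner = this
  have "(\<Sum>s\<in>{0..<p}. \<Sum>t\<in>{0..<p}. cmod (\<Sum>b\<in>{1..int B}. e (s * rcp (t + b))) ^ (2 * r))
    = (\<Sum>t\<in>{0..<p}. \<Sum>s\<in>{0..<p}. cmod (\<Sum>b\<in>{1..int B}. e (s * rcp (t + b))) ^ (2 * r))"
    by (rule sum.swap)
  also have "\<dots> = (\<Sum>t\<in>{0..<p}. real_of_int p * card {z \<in> \<Gamma> \<times> \<Gamma>. C t z})"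
    by (intro sum.cong refl inner)
  finally have eq: "(\<Sum>s\<in>{0..<p}. \<Sum>t\<in>{0..<p}. cmod (\<Sum>b\<in>{1..int B}. e (s * rcp (t + b))) ^ (2 * r))
    = (\<Sum>t\<in>{0..<p}. real_of_int p * card {z \<in> \<Gamma> \<times> \<Gamma>. C t z})" .
  have "(\<Sum>t\<in>{0..<p}. card {z \<in> \<Gamma> \<times> \<Gamma>. C t z}) = (\<Sum>z\<in>\<Gamma>\<times>\<Gamma>. card {t\<in>{0..<p}. C t z})"
    using fin by (intro sum_card_filter_swap) auto
  also have "\<dots> \<le> (\<Sum>z\<in>\<Gamma>\<times>\<Gamma>. 4 * r + (if bad z then nat p else 0))"
  proof (rule sum_mono)
    fix z assume z: "z \<in> \<Gamma> \<times> \<Gamma>"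
    show "card {t\<in>{0..<p}. C t z} \<le> 4 * r + (if bad z then nat p else 0)"
    proof (cases "bad z")
      case True
      have "card {t\<in>{0..<p}. C t z} \<le> card {0..<p}" by (intro card_mono) auto
      thus ?thesis using True by simp
    next
      case False
      then obtain b0 where b0: "card {i\<in>{..<r}. fst z i = b0} \<noteq> card {i\<in>{..<r}. snd z i = b0}"
        by (auto simp: bad_def)
      have "fst z \<in> {..<r} \<rightarrow> {1..int B}" "snd z \<in> {..<r} \<rightarrow> {1..int B}"
        using z by (auto simp: \<Gamma>_def mem_Times_iff PiE_iff)
      hence "card {t\<in>{0..<p}. C t z} \<le> 4 * r"
        unfolding C_def by (rule card_reciprocal_sums_coincide[OF _ _ B r b0])
      thus ?thesis by simp
    qed
  qed
  also have "\<dots> = 4 * r * B ^ (2 * r) + nat p * card {z\<in>\<Gamma>\<times>\<Gamma>. bad z}"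
  proof -
    have "card (\<Gamma> \<times> \<Gamma>) = B ^ (2 * r)"
      by (simp only: card_cartesian_product card\<Gamma> mult_2 power_add)
    moreover have "(\<Sum>z\<in>\<Gamma>\<times>\<Gamma>. if bad z then nat p else 0) = (\<Sum>z\<in>{z\<in>\<Gamma>\<times>\<Gamma>. bad z}. nat p)"
      using fin by (intro sum.inter_filter[symmetric] finite_cartesian_product)
    ultimately show ?thesis by (simp only: sum.distrib sum_constant of_nat_id mult.commute)
  qed
  finally have le: "(\<Sum>t\<in>{0..<p}. card {z \<in> \<Gamma> \<times> \<Gamma>. C t z})
      \<le> 4 * r * B ^ (2 * r) + nat p * card {z\<in>\<Gamma>\<times>\<Gamma>. bad z}" .
  have "card {z\<in>\<Gamma>\<times>\<Gamma>. bad z} \<le> B ^ r * r ^ r"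
  proof -
    \<comment> \<open>Of equal multiplicities only one consequence is kept: \<open>snd z\<close>
      takes its values in the range of \<open>fst z\<close>, which leaves at most r^r choices once
      \<open>fst z\<close> is fixed.\<close>
    have "{z\<in>\<Gamma>\<times>\<Gamma>. bad z} \<subseteq> (SIGMA g:\<Gamma>. PiE {..<r} (\<lambda>_. g ` {..<r}))"
    proof
      fix z assume z: "z \<in> {z\<in>\<Gamma>\<times>\<Gamma>. bad z}"
      have "snd z i \<in> fst z ` {..<r}" if "i < r" for i
      proof -
        have "card {j\<in>{..<r}. snd z j = snd z i} \<noteq> 0" using that by auto
        hence "card {j\<in>{..<r}. fst z j = snd z i} \<noteq> 0" using z by (auto simp: bad_def)
        hence "{j\<in>{..<r}. fst z j = snd z i} \<noteq> {}" by (metis card.empty)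
        thus ?thesis by force
      qed
      thus "z \<in> (SIGMA g:\<Gamma>. PiE {..<r} (\<lambda>_. g ` {..<r}))"
        using z by (auto simp: \<Gamma>_def PiE_iff)
    qed
    hence "card {z\<in>\<Gamma>\<times>\<Gamma>. bad z} \<le> card (SIGMA g:\<Gamma>. PiE {..<r} (\<lambda>_. g ` {..<r}))"
      using fin by (intro card_mono finite_SigmaI finite_PiE) auto
    also have "\<dots> = (\<Sum>g\<in>\<Gamma>. card (g ` {..<r}) ^ r)"
      using fin by (subst card_SigmaI) (auto intro!: finite_PiE simp: card_PiE)
    also have "\<dots> \<le> (\<Sum>g\<in>\<Gamma>. r ^ r)"
      using card_image_le[of "{..<r}"] by (intro sum_mono power_mono) auto
    finally show ?thesis by (simp add: card\<Gamma>)
  qed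
  hence "nat p * card {z\<in>\<Gamma>\<times>\<Gamma>. bad z} \<le> nat p * (B ^ r * r ^ r)"
    by (rule mult_le_mono2)
  hence "(\<Sum>t\<in>{0..<p}. card {z \<in> \<Gamma> \<times> \<Gamma>. C t z}) \<le> 4 * r * B ^ (2 * r) + nat p * (B ^ r * r ^ r)"
    using le by linarith
  hence "real (\<Sum>t\<in>{0..<p}. card {z \<in> \<Gamma> \<times> \<Gamma>. C t z}) \<le> real (4 * r * B ^ (2 * r) + nat p * (B ^ r * r ^ r))"
    by (rule of_nat_mono)
  hence "real_of_int p * real (\<Sum>t\<in>{0..<p}. card {z \<in> \<Gamma> \<times> \<Gamma>. C t z})
      \<le> real_of_int p * real (4 * r * B ^ (2 * r) + nat p * (B ^ r * r ^ r))"
    by (rule mult_left_mono) (use p_pos in simp)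
  moreover have "real_of_int p * real (4 * r * B ^ (2 * r) + nat p * (B ^ r * r ^ r))
      = real_of_int p * (real_of_int p * real B ^ r * real r ^ r + 4 * real r * real B ^ (2 * r))"
    using p_pos by (simp add: algebra_simps)
  ultimately show ?thesis unfolding eq by (simp only: of_nat_sum sum_distrib_left)
qed

end

section \<open>Lattice points and coincidences of quotients\<close>

lemma harm_le_ln: "n \<ge> 1 \<Longrightarrow> (harm n :: real) \<le> 1 + ln (real n)"
proof (induction n rule: nat_induct_at_least)
  case base thus ?case by (simp add: harm_def)
next
  case (Suc n)
  have "ln (real n / real (Suc n)) \<le> real n / real (Suc n) - 1"
    using Suc by (intro ln_le_minus_one) auto
  hence "inverse (real (Suc n)) \<le> ln (real (Suc n)) - ln (real n)"
    using Suc by (simp add: ln_div field_simps)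
  thus ?case using Suc by (simp add: harm_Suc)
qed

text \<open>A maximum \<open>u\<close> is attained in the first coordinate by \<open>u\<close>
  pairs, which together contribute 1/u; so each of the two coordinates contributes one harmonic
  sum.\<close>

lemma sum_inverse_max_squared_le:
  fixes A :: nat
  assumes "A \<ge> 1"
  shows "(\<Sum>v\<in>{1..int A}\<times>{1..int A}. 1 / (real_of_int (max (fst v) (snd v)))\<^sup>2) \<le> 2 * (1 + ln (real A))"
proof -
  let ?I = "{1..int A}"
  have half: "(\<Sum>u\<in>?I. \<Sum>w\<in>?I. if w \<le> u then 1 / (real_of_int u)\<^sup>2 else 0) = harm A"
  proof -
    have "(\<Sum>w\<in>?I. if w \<le> u then 1 / (real_of_int u)\<^sup>2 else 0) = inverse (real_of_int u)" if "u \<in> ?I" for u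
    proof -
      have "(\<Sum>w\<in>?I. if w \<le> u then 1 / (real_of_int u)\<^sup>2 else 0) = (\<Sum>w\<in>{w\<in>?I. w \<le> u}. 1 / (real_of_int u)\<^sup>2)"
        by (rule sum.inter_filter[symmetric]) simp
      also have "{w\<in>?I. w \<le> u} = {1..u}" using that by auto
      finally show ?thesis using that by (simp add: power2_eq_square field_simps)
    qed
    hence "(\<Sum>u\<in>?I. \<Sum>w\<in>?I. if w \<le> u then 1 / (real_of_int u)\<^sup>2 else 0) = (\<Sum>u\<in>?I. inverse (real_of_int u))"
      by (rule sum.cong[OF refl])
    also have "\<dots> = (\<Sum>k=1..A. inverse (real k))"
      by (rule sum.reindex_bij_witness[of _ int nat]) auto
    finally show ?thesis by (simp add: harm_def)
  qed
  have "(\<Sum>v\<in>?I\<times>?I. 1 / (real_of_int (max (fst v) (snd v)))\<^sup>2) =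
    (\<Sum>u\<in>?I. \<Sum>w\<in>?I. 1 / (real_of_int (max u w))\<^sup>2)"
    by (simp only: sum.cartesian_product case_prod_unfold)
  also have "\<dots> \<le> (\<Sum>u\<in>?I. \<Sum>w\<in>?I. (if w \<le> u then 1 / (real_of_int u)\<^sup>2 else 0) + (if u \<le> w then 1 / (real_of_int w)\<^sup>2 else 0))"
    by (intro sum_mono) (auto simp: max_def)
  also have "\<dots> = (\<Sum>u\<in>?I. \<Sum>w\<in>?I. if w \<le> u then 1 / (real_of_int u)\<^sup>2 else 0)
       + (\<Sum>u\<in>?I. \<Sum>w\<in>?I. if u \<le> w then 1 / (real_of_int w)\<^sup>2 else 0)"
    by (simp only: sum.distrib)
  also have "(\<Sum>u\<in>?I. \<Sum>w\<in>?I. if u \<le> w then 1 / (real_of_int w)\<^sup>2 else 0)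
      = (\<Sum>w\<in>?I. \<Sum>u\<in>?I. if u \<le> w then 1 / (real_of_int w)\<^sup>2 else 0)"
    by (rule sum.swap)
  finally show ?thesis using half harm_le_ln[OF assms] by simp
qed

section \<open>Points of a planar lattice in a box\<close>

context odd_prime
begin

definition lattice_box :: "int \<Rightarrow> int \<Rightarrow> (int \<times> int) set" where
  "lattice_box \<rho> X = {z \<in> {-X..X} \<times> {-X..X}. [fst z = \<rho> * snd z] (mod p)}"

definition ratio_pairs :: "int \<Rightarrow> int \<Rightarrow> (int \<times> int) set" where
  "ratio_pairs \<rho> A = {a \<in> {1..A} \<times> {1..A}. [fst a = \<rho> * snd a] (mod p)}"

text \<open>Junk value if no pair of positive integers up to \<open>A\<close> has ratio \<open>\<rho>\<close>.\<close>

definition height :: "int \<Rightarrow> int \<Rightarrow> int" where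
  "height \<rho> A = Min ((\<lambda>a. max (fst a) (snd a)) ` ratio_pairs \<rho> A)"

lemma finite_lattice_box: "finite (lattice_box \<rho> X)"
  by (auto simp: lattice_box_def intro: finite_subset[of _ "{-X..X} \<times> {-X..X}"])

lemma finite_ratio_pairs: "finite (ratio_pairs \<rho> A)"
  by (auto simp: ratio_pairs_def intro: finite_subset[of _ "{1..A} \<times> {1..A}"])

lemma height_le: "a \<in> ratio_pairs \<rho> A \<Longrightarrow> height \<rho> A \<le> max (fst a) (snd a)"
  unfolding height_def by (intro Min_le finite_imageI finite_ratio_pairs) auto

lemma obtain_height:
  assumes "ratio_pairs \<rho> A \<noteq> {}"
  obtains v where "v \<in> ratio_pairs \<rho> A" "height \<rho> A = max (fst v) (snd v)"
proof -
  have "height \<rho> A \<in> (\<lambda>a. max (fst a) (snd a)) ` ratio_pairs \<rho> A"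
    unfolding height_def using assms by (intro Min_in finite_imageI finite_ratio_pairs) auto
  thus ?thesis using that by blast
qed

lemma height_bounds:
  assumes "ratio_pairs \<rho> A \<noteq> {}" shows "1 \<le> height \<rho> A" "height \<rho> A \<le> A"
proof -
  obtain v where "v \<in> ratio_pairs \<rho> A" "height \<rho> A = max (fst v) (snd v)"
    by (rule obtain_height[OF assms])
  thus "1 \<le> height \<rho> A" "height \<rho> A \<le> A" by (auto simp: ratio_pairs_def)
qed

text \<open>A nonzero such vector may be taken with positive first coordinate; collinearity then
  makes the second one positive and carries the strict bound from one coordinate to the other. It
  would be a pair of ratio \<open>\<rho>\<close> with smaller maximum than (u, w), against the
  minimality in \<open>height\<close>.\<close>

lemma collinear_short_vector_zero:
  assumes v: "(u, w) \<in> ratio_pairs \<rho> A" and T: "height \<rho> A = max u w"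
    and col: "x * w = y * u" and lat: "[x = \<rho> * y] (mod p)"
    and short: "if w \<le> u then \<bar>x\<bar> < u else \<bar>y\<bar> < w"
  shows "x = 0 \<and> y = 0"
proof -
  have uw: "1 \<le> u" "u \<le> A" "1 \<le> w" "w \<le> A" using v by (auto simp: ratio_pairs_def)
  have no_pos: "\<not> x > 0" if col: "x * w = y * u" and lat: "[x = \<rho> * y] (mod p)"
    and short: "if w \<le> u then \<bar>x\<bar> < u else \<bar>y\<bar> < w" for x y
  proof
    assume x: "x > 0"
    hence "y * u > 0" using uw col by (metis less_le_trans mult_pos_pos zero_less_one)
    hence y: "y > 0" using uw by (simp add: zero_less_mult_iff)
    have "x < max u w \<and> y < max u w"
    proof (cases "w \<le> u")
      case True
      hence "y * u \<le> x * u" using x by (simp flip: col)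
      hence "y \<le> x" using uw by simp
      thus ?thesis using True short x by auto
    next
      case False
      hence "x * w \<le> y * w" using y by (simp add: col)
      hence "x \<le> y" using uw by simp
      thus ?thesis using False short y by auto
    qed
    moreover from this have "(x, y) \<in> ratio_pairs \<rho> A"
      using x y uw lat by (auto simp: ratio_pairs_def)
    ultimately show False using height_le[of "(x, y)" \<rho> A] T by auto
  qed
  have "\<not> x > 0" by (rule no_pos[OF col lat short])
  moreover have "\<not> - x > 0"
    by (rule no_pos[of "-x" "-y"]) (use col lat short in \<open>auto simp: cong_minus_minus_iff\<close>)
  ultimately have "x = 0" by simp
  thus ?thesis using col uw by simp
qed

text \<open>A point is encoded by its determinant against a shortest positive vector v, divided by
  \<open>p\<close>, and by the block of length \<open>T\<close> containing the coordinate in which v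
  is larger. Equal determinants make the difference of two points parallel to v, equal blocks make
  it shorter than v, so the code is injective. The two ranges have at most 4XT/p + 1 and 4X/T
  elements.\<close>

lemma card_lattice_box_le:
  assumes ne: "ratio_pairs \<rho> A \<noteq> {}" and X: "height \<rho> A \<le> X"
  shows "real (card (lattice_box \<rho> X)) \<le> 16 * real_of_int X ^ 2 / real_of_int p + 4 * real_of_int X / real_of_int (height \<rho> A)"
proof -
  define T where "T = height \<rho> A"
  obtain u w where v: "(u, w) \<in> ratio_pairs \<rho> A" and T: "T = max u w"
    using obtain_height[OF ne] by (metis T_def fst_conv snd_conv surj_pair)
  have uw: "1 \<le> u" "1 \<le> w" and lat_v: "[u = \<rho> * w] (mod p)" using v by (auto simp: ratio_pairs_def)
  have T1: "T \<ge> 1" "T \<le> X" using uw X by (auto simp: T T_def[symmetric])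
  define K where "K = 2 * X * T div p"
  define f where "f z = ((fst z * w - snd z * u) div p, (if w \<le> u then fst z else snd z) div T)" for z
  have dvd: "p dvd fst z * w - snd z * u" if "z \<in> lattice_box \<rho> X" for z
  proof -
    have "[fst z * w = \<rho> * snd z * w] (mod p)" "[snd z * u = snd z * (\<rho> * w)] (mod p)"
      using that lat_v by (auto simp: lattice_box_def intro: cong_mult)
    hence "[fst z * w - snd z * u = \<rho> * snd z * w - snd z * (\<rho> * w)] (mod p)" by (rule cong_diff)
    thus ?thesis by (simp add: cong_0_iff mult_ac)
  qed
  have "f ` lattice_box \<rho> X \<subseteq> {-K..K} \<times> {(- X) div T..X div T}"
  proof (rule image_subsetI)
    fix z assume z: "z \<in> lattice_box \<rho> X"
    hence zX: "\<bar>fst z\<bar> \<le> X" "\<bar>snd z\<bar> \<le> X" by (auto simp: lattice_box_def)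
    obtain k where k: "fst z * w - snd z * u = p * k" using dvd[OF z] by (elim dvdE)
    have "\<bar>fst z * w\<bar> \<le> X * T" "\<bar>snd z * u\<bar> \<le> X * T"
      unfolding abs_mult using zX uw T1 by (intro mult_mono; simp add: T)+
    hence *: "\<bar>p * k\<bar> \<le> 2 * X * T" unfolding k[symmetric] by linarith
    have "j \<le> K" if "p * j \<le> 2 * X * T" for j
      using zdiv_mono1[OF that p_pos(1)] p_pos by (simp add: K_def)
    from this[of k] this[of "- k"] * have "k \<le> K" "- k \<le> K" by (simp_all add: abs_le_iff)
    moreover have "(if w \<le> u then fst z else snd z) div T \<in> {(- X) div T..X div T}"
      using zX T1 by (auto intro!: zdiv_mono1)
    moreover have "(fst z * w - snd z * u) div p = k" using p_pos by (simp add: k)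
    ultimately show "f z \<in> {-K..K} \<times> {(- X) div T..X div T}"
      by (simp add: f_def)
  qed
  moreover have "inj_on f (lattice_box \<rho> X)"
  proof
    fix z y assume z: "z \<in> lattice_box \<rho> X" and y: "y \<in> lattice_box \<rho> X" and fzy: "f z = f y"
    have "fst z * w - snd z * u = fst y * w - snd y * u"
      using fzy dvd[OF z] dvd[OF y] p_pos by (auto simp: f_def elim!: dvdE)
    hence col: "(fst z - fst y) * w = (snd z - snd y) * u" by (simp add: algebra_simps)
    have lat: "[fst z - fst y = \<rho> * (snd z - snd y)] (mod p)"
      using z y unfolding right_diff_distrib by (auto simp: lattice_box_def intro!: cong_diff)
    have close: "\<bar>a - b\<bar> < T" if "a div T = b div T" for a b
    proof -
      have "a - b = a mod T - b mod T"
        using that minus_div_mult_eq_mod[of a T] minus_div_mult_eq_mod[of b T] by simp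
      moreover have "0 \<le> a mod T" "a mod T < T" "0 \<le> b mod T" "b mod T < T" using T1 by simp_all
      ultimately show ?thesis by linarith
    qed
    have "if w \<le> u then \<bar>fst z - fst y\<bar> < u else \<bar>snd z - snd y\<bar> < w"
    proof (cases "w \<le> u")
      case True
      thus ?thesis using close[of "fst z" "fst y"] fzy by (simp add: f_def T)
    next
      case False
      thus ?thesis using close[of "snd z" "snd y"] fzy by (simp add: f_def T)
    qed
    hence "fst z - fst y = 0 \<and> snd z - snd y = 0"
      using collinear_short_vector_zero[OF v _ col lat] T T_def by simp
    thus "z = y" by (simp add: prod_eq_iff)
  qed
  ultimately have "card (lattice_box \<rho> X) \<le> card ({-K..K} \<times> {(- X) div T..X div T})"
    by (intro card_inj_on_le[where f = f]) auto
  hence "real (card (lattice_box \<rho> X)) \<le> real (card {-K..K}) * real (card {(- X) div T..X div T})"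
    by (simp only: card_cartesian_product of_nat_mult[symmetric] of_nat_le_iff)
  also have "\<dots> \<le> (4 * real_of_int X * real_of_int T / real_of_int p + 1) * (4 * real_of_int X / real_of_int T)"
  proof (rule mult_mono)
    have div_le: "real_of_int (a div b) \<le> real_of_int a / real_of_int b" for a b :: int
      using of_int_floor_le[of "real_of_int a / real_of_int b"] by (simp add: floor_divide_of_int_eq)
    have "real_of_int K \<le> real_of_int (2 * X * T) / real_of_int p"
      unfolding K_def by (rule div_le)
    moreover have "K \<ge> 0" unfolding K_def using T1 p_pos by (intro pos_imp_zdiv_nonneg_iff[THEN iffD2]) auto
    ultimately show "real (card {-K..K}) \<le> 4 * real_of_int X * real_of_int T / real_of_int p + 1"
      by simp
    have "real_of_int (X div T) \<le> real_of_int X / real_of_int T"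
      by (rule div_le)
    moreover have "real_of_int (- X) / real_of_int T - 1 \<le> real_of_int ((- X) div T)"
      using real_of_int_floor_gt_diff_one[of "real_of_int (- X) / real_of_int T"]
      unfolding floor_divide_of_int_eq by linarith
    \<comment> \<open>The number of blocks is at most 2X/T + 2; since \<open>T \<le> X\<close>, the
      2 is absorbed and 4X/T remains.\<close>
    moreover have "1 \<le> real_of_int X / real_of_int T" using T1 by simp
    moreover have "(- X) div T \<le> X div T" using T1 by (intro zdiv_mono1) auto
    ultimately show "real (card {(- X) div T..X div T}) \<le> 4 * real_of_int X / real_of_int T"
      by simp
  qed (use T1 p_pos in auto)
  also have "\<dots> = 16 * real_of_int X ^ 2 / real_of_int p + 4 * real_of_int X / real_of_int T"
    using T1 p_pos by (simp add: field_simps power2_eq_square)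
  finally show ?thesis by (simp add: T_def)
qed

lemma card_ratio_pairs_le:
  assumes ne: "ratio_pairs \<rho> A \<noteq> {}"
  shows "real (card (ratio_pairs \<rho> A)) \<le> 16 * real_of_int A ^ 2 / real_of_int p + 4 * real_of_int A / real_of_int (height \<rho> A)"
proof -
  have "ratio_pairs \<rho> A \<subseteq> lattice_box \<rho> A" by (auto simp: ratio_pairs_def lattice_box_def)
  hence "card (ratio_pairs \<rho> A) \<le> card (lattice_box \<rho> A)"
    by (intro card_mono finite_lattice_box)
  thus ?thesis using card_lattice_box_le[OF ne height_bounds(2)[OF ne]] by linarith
qed

text \<open>Choosing for each \<open>\<rho>\<close> a pair that attains its height is injective,
  because the pair determines \<open>\<rho>\<close> as a quotient modulo \<open>p\<close>. The sum
  is thus dominated by the one over all pairs, which is logarithmic.\<close>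

lemma sum_inverse_height_squared_le:
  assumes A: "A \<ge> 1" "int A < p"
  shows "(\<Sum>\<rho>\<in>{\<rho>\<in>{1..<p}. ratio_pairs \<rho> (int A) \<noteq> {}}. 1 / (real_of_int (height \<rho> (int A)))\<^sup>2) \<le> 2 * (1 + ln (real A))"
proof -
  define R where "R = {\<rho>\<in>{1..<p}. ratio_pairs \<rho> (int A) \<noteq> {}}"
  have "\<exists>v. v \<in> ratio_pairs \<rho> (int A) \<and> height \<rho> (int A) = max (fst v) (snd v)" if \<rho>: "\<rho> \<in> R" for \<rho>
  proof -
    have "ratio_pairs \<rho> (int A) \<noteq> {}" using \<rho> by (simp add: R_def)
    then obtain v where "v \<in> ratio_pairs \<rho> (int A)" "height \<rho> (int A) = max (fst v) (snd v)"
      by (rule obtain_height)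
    thus ?thesis by blast
  qed
  then obtain v where v: "\<And>\<rho>. \<rho> \<in> R \<Longrightarrow> v \<rho> \<in> ratio_pairs \<rho> (int A)"
    "\<And>\<rho>. \<rho> \<in> R \<Longrightarrow> height \<rho> (int A) = max (fst (v \<rho>)) (snd (v \<rho>))" by metis
  have "inj_on v R"
  proof
    fix \<rho> \<sigma> assume \<rho>: "\<rho> \<in> R" and \<sigma>: "\<sigma> \<in> R" and eq: "v \<rho> = v \<sigma>"
    have "\<not> p dvd snd (v \<rho>)" using v(1)[OF \<rho>] A by (intro not_dvd_unit) (auto simp: ratio_pairs_def)
    moreover have "[\<rho> * snd (v \<rho>) = \<sigma> * snd (v \<rho>)] (mod p)"
      using v(1)[OF \<rho>] v(1)[OF \<sigma>] eq by (auto simp: ratio_pairs_def intro: cong_trans cong_sym)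
    ultimately have "[\<rho> = \<sigma>] (mod p)" using cong_mult_rcancel by blast
    thus "\<rho> = \<sigma>" using \<rho> \<sigma> by (auto simp: R_def Cong.cong_def)
  qed
  hence "(\<Sum>\<rho>\<in>R. 1 / (real_of_int (height \<rho> (int A)))\<^sup>2) = (\<Sum>w\<in>v ` R. 1 / (real_of_int (max (fst w) (snd w)))\<^sup>2)"
    using v(2) by (simp add: sum.reindex)
  also have "\<dots> \<le> (\<Sum>w\<in>{1..int A}\<times>{1..int A}. 1 / (real_of_int (max (fst w) (snd w)))\<^sup>2)"
    using v(1) by (intro sum_mono2) (auto simp: ratio_pairs_def image_subset_iff)
  also have "\<dots> \<le> 2 * (1 + ln (real A))" by (rule sum_inverse_max_squared_le[OF A(1)])
  finally show ?thesis by (simp add: R_def)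
qed


text \<open>Pairs with difference zero are set aside because they determine no ratio; they form the
  diagonal part of the squared weighted sum, which is bounded trivially.\<close>

definition off_diagonal :: "int set \<Rightarrow> (int \<times> int) set" where
  "off_diagonal M = {\<mu> \<in> M \<times> M. fst \<mu> \<noteq> snd \<mu>}"

text \<open>The off-diagonal part of the additive energy of \<open>M\<close> and its dilate by
  \<open>\<rho>\<close>.\<close>

definition ratio_energy :: "int set \<Rightarrow> int \<Rightarrow> ((int \<times> int) \<times> (int \<times> int)) set" where
  "ratio_energy M \<rho> = {\<nu> \<in> off_diagonal M \<times> off_diagonal M.
     [fst (fst \<nu>) - snd (fst \<nu>) = \<rho> * (fst (snd \<nu>) - snd (snd \<nu>))] (mod p)}"

lemma finite_off_diagonal: "finite M \<Longrightarrow> finite (off_diagonal M)"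
  by (auto simp: off_diagonal_def)

lemma finite_ratio_energy: "finite M \<Longrightarrow> finite (ratio_energy M \<rho>)"
  unfolding ratio_energy_def by (intro finite_Collect_conjI disjI1) (simp add: finite_off_diagonal)

lemma card_off_diagonal_le: "finite M \<Longrightarrow> card (off_diagonal M) \<le> card M ^ 2"
  using card_mono[of "M \<times> M" "off_diagonal M"] by (auto simp: off_diagonal_def power2_eq_square)

lemma card_ratio_energy_le:
  assumes M: "M \<subseteq> {0..<p}"
  shows "card (ratio_energy M \<rho>) \<le> card M ^ 3"
proof -
  have fin: "finite M" using M finite_subset by blast
  let ?f = "\<lambda>\<nu>. (snd (fst \<nu>), snd \<nu>)"
  have "inj_on ?f (ratio_energy M \<rho>)"
  proof
    fix x y assume x: "x \<in> ratio_energy M \<rho>" and y: "y \<in> ratio_energy M \<rho>" and xy: "?f x = ?f y"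
    have "[fst (fst x) - snd (fst x) = fst (fst y) - snd (fst x)] (mod p)"
      using x y xy by (auto simp: ratio_energy_def intro: cong_trans cong_sym)
    hence "[fst (fst x) = fst (fst y)] (mod p)" by (simp add: cong_iff_dvd_diff)
    moreover have "fst (fst x) \<in> {0..<p}" "fst (fst y) \<in> {0..<p}"
      using x y M by (auto simp: ratio_energy_def off_diagonal_def)
    ultimately have "fst (fst x) = fst (fst y)" by (auto simp: Cong.cong_def)
    thus "x = y" using xy by (simp add: prod_eq_iff)
  qed
  moreover have "?f ` ratio_energy M \<rho> \<subseteq> M \<times> (M \<times> M)"
    by (auto simp: ratio_energy_def off_diagonal_def)
  ultimately have "card (ratio_energy M \<rho>) \<le> card (M \<times> (M \<times> M))"
    using fin by (intro card_inj_on_le) auto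
  thus ?thesis by (simp add: power3_eq_cube mult.assoc card_cartesian_product)
qed

text \<open>The sets for different \<open>\<rho>\<close> are disjoint: a difference of distinct
  elements of \<open>M\<close> is invertible modulo \<open>p\<close>, so two differences determine
  their ratio.\<close>

lemma sum_card_ratio_energy_le:
  assumes M: "M \<subseteq> {0..<p}"
  shows "(\<Sum>\<rho>\<in>{1..<p}. card (ratio_energy M \<rho>)) \<le> card M ^ 4"
proof -
  have fin: "finite M" using M finite_subset by blast
  have "(\<Sum>\<rho>\<in>{1..<p}. card (ratio_energy M \<rho>)) = card (SIGMA \<rho>:{1..<p}. ratio_energy M \<rho>)"
    using finite_ratio_energy[OF fin] by simp
  also have "\<dots> \<le> card ((M \<times> M) \<times> (M \<times> M))"
  proof (rule card_inj_on_le[where f = snd])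
    show "inj_on snd (SIGMA \<rho>:{1..<p}. ratio_energy M \<rho>)"
    proof
      fix x y assume x: "x \<in> (SIGMA \<rho>:{1..<p}. ratio_energy M \<rho>)"
        and y: "y \<in> (SIGMA \<rho>:{1..<p}. ratio_energy M \<rho>)" and xy: "snd x = snd y"
      define d where "d = fst (snd (snd x)) - snd (snd (snd x))"
      have mem: "fst (snd (snd x)) \<in> {0..<p}" "snd (snd (snd x)) \<in> {0..<p}" and "d \<noteq> 0"
        using x M by (auto simp: ratio_energy_def off_diagonal_def d_def)
      hence "\<not> p dvd d" using dvd_imp_le_int[of d p] by (auto simp: d_def)
      moreover have "[fst x * d = fst y * d] (mod p)"
        using x y xy cong_trans[OF cong_sym] by (auto simp: ratio_energy_def d_def)
      ultimately have "[fst x = fst y] (mod p)" using cong_mult_rcancel by blast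
      hence "fst x = fst y" using x y by (auto simp: Cong.cong_def)
      thus "x = y" using xy by (simp add: prod_eq_iff)
    qed
  qed (use fin in \<open>auto simp: ratio_energy_def off_diagonal_def\<close>)
  also have "\<dots> = card M ^ 4" by (simp add: power4_eq_xxxx card_cartesian_product)
  finally show ?thesis .
qed

section \<open>Counting coincidences of quotients\<close>

definition quadruples :: "int set \<Rightarrow> int \<Rightarrow> int \<Rightarrow> ((int \<times> int) \<times> int \<times> int) set" where
  "quadruples M X A = off_diagonal M \<times> ({- X..X} \<times> {1..A})"

text \<open>Dividing the difference and the shift by \<open>a\<close> gives the frequency s and the
  offset t at which the reciprocal sum over b is evaluated; reduction modulo \<open>p\<close> turns
  congruence of quotients into equality.\<close>

definition quotients :: "(int \<times> int) \<times> int \<times> int \<Rightarrow> int \<times> int" where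
  "quotients = (\<lambda>(\<mu>, z, a). ((fst \<mu> - snd \<mu>) * rcp a mod p, z * rcp a mod p))"

lemma finite_quadruples: "finite M \<Longrightarrow> finite (quadruples M X A)"
  by (simp add: quadruples_def finite_off_diagonal)

text \<open>With \<open>\<rho>\<close> the residue of a/a', a coincidence says that (a, a'), (z, z')
  and the two differences all have ratio \<open>\<rho>\<close>. For fixed \<open>\<rho>\<close> the
  three conditions are independent, whence the product.\<close>

lemma card_quotient_coincidences_le:
  assumes M: "M \<subseteq> {0..<p}" and A: "A < p"
  shows "card {(\<omega>, \<omega>'). \<omega> \<in> quadruples M X A \<and> \<omega>' \<in> quadruples M X A \<and> quotients \<omega> = quotients \<omega>'}
    \<le> (\<Sum>\<rho>\<in>{1..<p}. card (ratio_pairs \<rho> A) * (card (lattice_box \<rho> X) * card (ratio_energy M \<rho>)))"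
proof -
  have fin: "finite M" using M finite_subset by blast
  define f where "f = (\<lambda>((\<mu>, z, a), (\<mu>', z', a')). (a * rcp a' mod p, ((a, a'), ((z, z'), (\<mu>, \<mu>'))))
    :: int \<times> (int \<times> int) \<times> (int \<times> int) \<times> (int \<times> int) \<times> (int \<times> int))"
  let ?S = "SIGMA \<rho>:{1..<p}. ratio_pairs \<rho> A \<times> (lattice_box \<rho> X \<times> ratio_energy M \<rho>)"
  let ?C = "{(\<omega>, \<omega>'). \<omega> \<in> quadruples M X A \<and> \<omega>' \<in> quadruples M X A \<and> quotients \<omega> = quotients \<omega>'}"
  have "f ` ?C \<subseteq> ?S"
  proof (rule image_subsetI)
    fix c assume "c \<in> ?C"
    then obtain \<mu> z a \<mu>' z' a' where c: "c = ((\<mu>, z, a), (\<mu>', z', a'))"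
      and in1: "\<mu> \<in> off_diagonal M" "z \<in> {-X..X}" "a \<in> {1..A}"
      and in2: "\<mu>' \<in> off_diagonal M" "z' \<in> {-X..X}" "a' \<in> {1..A}"
      and q1: "[(fst \<mu> - snd \<mu>) * rcp a = (fst \<mu>' - snd \<mu>') * rcp a'] (mod p)"
      and q2: "[z * rcp a = z' * rcp a'] (mod p)"
      by (auto simp: quadruples_def quotients_def Cong.cong_def)
    have nd: "\<not> p dvd a" "\<not> p dvd a'" using in1 in2 A by (auto intro!: not_dvd_unit)
    define \<rho> where "\<rho> = a * rcp a' mod p"
    have "\<not> p dvd a * rcp a'" using nd prime by (simp add: prime_dvd_mult_iff rcp_dvd_iff)
    hence "\<rho> \<noteq> 0" by (simp add: \<rho>_def dvd_eq_mod_eq_0)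
    moreover have "0 \<le> \<rho>" "\<rho> < p" using p_pos by (simp_all add: \<rho>_def)
    ultimately have \<rho>: "\<rho> \<in> {1..<p}" by auto
    have \<rho>_cong: "[\<rho> = a * rcp a'] (mod p)" by (simp add: \<rho>_def Cong.cong_def)
    hence "[a * rcp a' = \<rho>] (mod p)" by (rule cong_sym)
    hence "[a = \<rho> * a'] (mod p)" using cong_mult_rcp_iff[OF nd(2)] by blast
    hence 1: "(a, a') \<in> ratio_pairs \<rho> A" using in1 in2 by (simp add: ratio_pairs_def)
    have transfer: "[x = \<rho> * y] (mod p)" if "[x * rcp a = y * rcp a'] (mod p)" for x y
    proof -
      have "[x = y * rcp a' * a] (mod p)" using that cong_mult_rcp_iff[OF nd(1)] by blast
      also have "y * rcp a' * a = a * rcp a' * y" by simp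
      also have "[\<dots> = \<rho> * y] (mod p)" using \<rho>_cong by (intro cong_mult cong_refl) (rule cong_sym)
      finally show ?thesis .
    qed
    have 2: "(z, z') \<in> lattice_box \<rho> X" using in1 in2 transfer[OF q2] by (simp add: lattice_box_def)
    have 3: "(\<mu>, \<mu>') \<in> ratio_energy M \<rho>" using in1 in2 transfer[OF q1] by (simp add: ratio_energy_def)
    show "f c \<in> ?S" using \<rho> 1 2 3 by (simp add: f_def c flip: \<rho>_def)
  qed
  moreover have "inj_on f ?C" by (auto simp: f_def inj_on_def)
  ultimately have "card ?C \<le> card ?S"
    using fin finite_ratio_pairs finite_lattice_box finite_ratio_energy
    by (intro card_inj_on_le[where f = f]) auto
  also have "\<dots> = (\<Sum>\<rho>\<in>{1..<p}. card (ratio_pairs \<rho> A) * (card (lattice_box \<rho> X) * card (ratio_energy M \<rho>)))"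
    using fin finite_ratio_pairs finite_lattice_box finite_ratio_energy
    by (simp add: card_cartesian_product)
  finally show ?thesis .
qed

text \<open>Multiplying out the two lattice bounds leaves the energies weighted by 1, 1/T and 1/T^2.
  The first sum is bounded by the total energy m^4, the last by the pointwise bound m^3 times a
  logarithm, and the middle one by interpolation, which produces the power 7/2.\<close>

lemma weighted_lattice_sum_le:
  fixes A X :: nat
  assumes M: "M \<subseteq> {0..<p}" and A: "A \<ge> 1" "int A < p" and X: "A \<le> X"
  defines "m \<equiv> real (card M)" and "L \<equiv> 2 * (1 + ln (real A))" and "q \<equiv> real_of_int p"
  shows "(\<Sum>\<rho>\<in>{1..<p}. real (card (ratio_pairs \<rho> (int A))) * (real (card (lattice_box \<rho> (int X))) * real (card (ratio_energy M \<rho>))))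
    \<le> 256 * real A ^ 2 * real X ^ 2 / q ^ 2 * m ^ 4
       + 128 * real A * real X ^ 2 / q * (m ^ 3 * sqrt m * L) + 16 * real A * real X * (m ^ 3 * L)"
proof -
  define R where "R = {\<rho>\<in>{1..<p}. ratio_pairs \<rho> (int A) \<noteq> {}}"
  define T where "T \<rho> = real_of_int (height \<rho> (int A))" for \<rho>
  define E where "E \<rho> = real (card (ratio_energy M \<rho>))" for \<rho>
  define a where "a = real A"
  define x where "x = real X"
  have finR: "R \<subseteq> {1..<p}" "finite R" by (auto simp: R_def intro: finite_subset[of _ "{1..<p}"])
  have ax: "1 \<le> a" "a \<le> x" "q > 0" using A X p_pos by (auto simp: a_def x_def q_def)
  have L: "L \<ge> 1" using A by (simp add: L_def)
  have E0: "E \<rho> \<ge> 0" for \<rho> by (simp add: E_def)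
  have T: "1 \<le> T \<rho>" if "\<rho> \<in> R" for \<rho>
    using height_bounds(1)[of \<rho> "int A"] that by (simp add: R_def T_def)
  have "(\<Sum>\<rho>\<in>{1..<p}. real (card (ratio_pairs \<rho> (int A))) * (real (card (lattice_box \<rho> (int X))) * E \<rho>))
      = (\<Sum>\<rho>\<in>R. real (card (ratio_pairs \<rho> (int A))) * (real (card (lattice_box \<rho> (int X))) * E \<rho>))"
    by (rule sum.mono_neutral_right) (auto simp: R_def)
  also have "\<dots> \<le> (\<Sum>\<rho>\<in>R. (16 * a ^ 2 / q + 4 * a / T \<rho>) * ((16 * x ^ 2 / q + 4 * x / T \<rho>) * E \<rho>))"
  proof (rule sum_mono)
    fix \<rho> assume \<rho>: "\<rho> \<in> R"
    hence ne: "ratio_pairs \<rho> (int A) \<noteq> {}" by (simp add: R_def)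
    have "real (card (ratio_pairs \<rho> (int A))) \<le> 16 * a ^ 2 / q + 4 * a / T \<rho>"
      using card_ratio_pairs_le[OF ne] by (simp add: a_def q_def T_def)
    moreover have "real (card (lattice_box \<rho> (int X))) \<le> 16 * x ^ 2 / q + 4 * x / T \<rho>"
      using card_lattice_box_le[OF ne, of "int X"] height_bounds(2)[OF ne] X by (simp add: x_def q_def T_def)
    ultimately show "real (card (ratio_pairs \<rho> (int A))) * (real (card (lattice_box \<rho> (int X))) * E \<rho>)
      \<le> (16 * a ^ 2 / q + 4 * a / T \<rho>) * ((16 * x ^ 2 / q + 4 * x / T \<rho>) * E \<rho>)"
      using ax T[OF \<rho>] E0 by (intro mult_mono) auto
  qed
  also have "\<dots> \<le> (\<Sum>\<rho>\<in>R. 256 * a^2 * x^2 / q^2 * E \<rho> + 128 * a * x^2 / q * (E \<rho> / T \<rho>) + 16 * a * x * (E \<rho> / (T \<rho>)\<^sup>2))"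
  proof (rule sum_mono)
    fix \<rho> assume \<rho>: "\<rho> \<in> R"
    have "(16 * a ^ 2 / q + 4 * a / T \<rho>) * ((16 * x ^ 2 / q + 4 * x / T \<rho>) * E \<rho>)
      = 256 * a^2 * x^2 / q^2 * E \<rho> + (64 * (a * a) * x + 64 * a * x ^ 2) / q * (E \<rho> / T \<rho>) + 16 * a * x * (E \<rho> / (T \<rho>)\<^sup>2)"
      using T[OF \<rho>] ax by (simp add: field_simps power2_eq_square)
    \<comment> \<open>Of the two cross terms, a^2 x is absorbed into a x^2, as
      \<open>a \<le> x\<close>.\<close>
    moreover have "(64 * (a * a) * x + 64 * a * x ^ 2) / q * (E \<rho> / T \<rho>) \<le> 128 * a * x^2 / q * (E \<rho> / T \<rho>)"
    proof (intro mult_right_mono divide_right_mono)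
      have "a * a * x \<le> a * x * x" using ax by (intro mult_right_mono mult_left_mono) auto
      thus "64 * (a * a) * x + 64 * a * x ^ 2 \<le> 128 * a * x\<^sup>2" by (simp add: power2_eq_square mult_ac)
    qed (use ax T[OF \<rho>] E0 in auto)
    ultimately show "(16 * a ^ 2 / q + 4 * a / T \<rho>) * ((16 * x ^ 2 / q + 4 * x / T \<rho>) * E \<rho>)
      \<le> 256 * a^2 * x^2 / q^2 * E \<rho> + 128 * a * x^2 / q * (E \<rho> / T \<rho>) + 16 * a * x * (E \<rho> / (T \<rho>)\<^sup>2)"
      by linarith
  qed
  also have "\<dots> = 256 * a^2 * x^2 / q^2 * (\<Sum>\<rho>\<in>R. E \<rho>) + 128 * a * x^2 / q * (\<Sum>\<rho>\<in>R. E \<rho> / T \<rho>)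
      + 16 * a * x * (\<Sum>\<rho>\<in>R. E \<rho> / (T \<rho>)\<^sup>2)"
    by (simp only: sum.distrib sum_distrib_left)
  also have "\<dots> \<le> 256 * a^2 * x^2 / q^2 * m ^ 4 + 128 * a * x^2 / q * (m ^ 3 * sqrt m * L) + 16 * a * x * (m ^ 3 * L)"
  proof -
    have s0: "(\<Sum>\<rho>\<in>R. E \<rho>) \<le> m ^ 4"
    proof -
      have "(\<Sum>\<rho>\<in>R. E \<rho>) \<le> (\<Sum>\<rho>\<in>{1..<p}. E \<rho>)"
        using finR E0 by (intro sum_mono2) auto
      also have "\<dots> = real (\<Sum>\<rho>\<in>{1..<p}. card (ratio_energy M \<rho>))" by (simp add: E_def)
      also have "\<dots> \<le> real (card M ^ 4)"
        by (intro of_nat_mono sum_card_ratio_energy_le[OF M])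
      finally show ?thesis by (simp add: m_def)
    qed
    have s2: "(\<Sum>\<rho>\<in>R. E \<rho> / (T \<rho>)\<^sup>2) \<le> m ^ 3 * L"
    proof -
      have "(\<Sum>\<rho>\<in>R. E \<rho> / (T \<rho>)\<^sup>2) \<le> (\<Sum>\<rho>\<in>R. m ^ 3 * (1 / (T \<rho>)\<^sup>2))"
      proof (rule sum_mono)
        fix \<rho>
        have "E \<rho> \<le> m ^ 3"
          unfolding E_def m_def of_nat_power[symmetric] by (intro of_nat_mono card_ratio_energy_le[OF M])
        thus "E \<rho> / (T \<rho>)\<^sup>2 \<le> m ^ 3 * (1 / (T \<rho>)\<^sup>2)" by (simp add: divide_right_mono)
      qed
      also have "\<dots> = m ^ 3 * (\<Sum>\<rho>\<in>R. 1 / (T \<rho>)\<^sup>2)" by (simp only: sum_distrib_left)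
      also have "\<dots> \<le> m ^ 3 * L"
        using sum_inverse_height_squared_le[OF A] by (intro mult_left_mono) (auto simp: R_def T_def L_def m_def)
      finally show ?thesis .
    qed
    \<comment> \<open>Cauchy-Schwarz between \<open>s0\<close> and \<open>s2\<close> gives the
      square root of m^7 L; as \<open>L \<ge> 1\<close>, its square root may be replaced by
      \<open>L\<close>.\<close>
    have s1: "(\<Sum>\<rho>\<in>R. E \<rho> / T \<rho>) \<le> m ^ 3 * sqrt m * L"
    proof (rule power2_le_imp_le)
      have "(\<Sum>\<rho>\<in>R. E \<rho> / T \<rho>)\<^sup>2 = (\<Sum>\<rho>\<in>R. sqrt (E \<rho>) * (sqrt (E \<rho>) / T \<rho>))\<^sup>2"
        by (simp add: E0)
      also have "\<dots> \<le> (\<Sum>\<rho>\<in>R. (sqrt (E \<rho>))\<^sup>2) * (\<Sum>\<rho>\<in>R. (sqrt (E \<rho>) / T \<rho>)\<^sup>2)"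
        by (rule Cauchy_Schwarz_ineq_sum)
      also have "\<dots> = (\<Sum>\<rho>\<in>R. E \<rho>) * (\<Sum>\<rho>\<in>R. E \<rho> / (T \<rho>)\<^sup>2)"
        using E0 by (simp add: power_divide)
      also have "\<dots> \<le> m ^ 4 * (m ^ 3 * L)"
        using E0 by (intro mult_mono s0 s2 sum_nonneg divide_nonneg_nonneg) (auto simp: m_def)
      also have "\<dots> \<le> m ^ 7 * L * L"
        using L mult_left_mono[of 1 L "m ^ 7 * L"] by (simp add: m_def flip: mult.assoc power_add)
      also have "\<dots> = (m ^ 3 * sqrt m * L)\<^sup>2"
        by (simp add: power_mult_distrib m_def power2_eq_square eval_nat_numeral)
      finally show "(\<Sum>\<rho>\<in>R. E \<rho> / T \<rho>)\<^sup>2 \<le> (m ^ 3 * sqrt m * L)\<^sup>2" .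
      show "0 \<le> m ^ 3 * sqrt m * L" using L by (simp add: m_def)
    qed
    show ?thesis using ax by (intro add_mono mult_left_mono s0 s1 s2) auto
  qed
  finally show ?thesis by (simp add: a_def x_def E_def)
qed

lemma quotient_coincidences_le:
  fixes A X :: nat
  assumes M: "M \<subseteq> {0..<p}" and A: "A \<ge> 1" "int A < p" and X: "A \<le> X"
  defines "m \<equiv> real (card M)" and "L \<equiv> 2 * (1 + ln (real A))" and "q \<equiv> real_of_int p"
  shows "real (card {(\<omega>, \<omega>'). \<omega> \<in> quadruples M (int X) (int A) \<and> \<omega>' \<in> quadruples M (int X) (int A) \<and> quotients \<omega> = quotients \<omega>'})
    \<le> 256 * real A ^ 2 * real X ^ 2 / q ^ 2 * m ^ 4
       + 128 * real A * real X ^ 2 / q * (m ^ 3 * sqrt m * L) + 16 * real A * real X * (m ^ 3 * L)"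
proof -
  have "real (card {(\<omega>, \<omega>'). \<omega> \<in> quadruples M (int X) (int A) \<and> \<omega>' \<in> quadruples M (int X) (int A) \<and> quotients \<omega> = quotients \<omega>'})
    \<le> real (\<Sum>\<rho>\<in>{1..<p}. card (ratio_pairs \<rho> (int A)) * (card (lattice_box \<rho> (int X)) * card (ratio_energy M \<rho>)))"
    by (intro of_nat_mono card_quotient_coincidences_le[OF M A(2)])
  also have "\<dots> = (\<Sum>\<rho>\<in>{1..<p}. real (card (ratio_pairs \<rho> (int A))) * (real (card (lattice_box \<rho> (int X))) * real (card (ratio_energy M \<rho>))))"
    by simp
  finally show ?thesis
    using weighted_lattice_sum_le[OF M A X] unfolding m_def L_def q_def by linarith
qed


section \<open>Hoelder's inequality and the shift by products\<close>

definition recip_sum :: "nat \<Rightarrow> int \<times> int \<Rightarrow> complex" where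
  "recip_sum B = (\<lambda>(s, t). \<Sum>b\<in>{1..int B}. e (s * rcp (t + b)))"

lemma quotients_in: "quotients \<omega> \<in> {0..<p} \<times> {0..<p}"
  using p_pos by (auto simp: quotients_def split: prod.splits)

text \<open>The power mean inequality with exponent \<open>r\<close> over the quadruples, then
  Cauchy-Schwarz over the values of \<open>quotients\<close>. The multiplicities enter only through
  their sum of squares \<open>N\<^sub>2\<close>, and nonnegativity allows the moment to run over all
  pairs (s, t).\<close>

lemma quadruple_sum_power_le:
  fixes A B X r :: nat
  assumes M: "M \<subseteq> {0..<p}" and A: "A \<ge> 1" "int A < p" and X: "A \<le> X"
    and B: "int B < p" and r: "r \<ge> 1" "int r < p"
  defines "N\<^sub>2 \<equiv> real (card {(\<omega>, \<omega>'). \<omega> \<in> quadruples M (int X) (int A) \<and> \<omega>' \<in> quadruples M (int X) (int A) \<and> quotients \<omega> = quotients \<omega>'})"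
  shows "(\<Sum>\<omega>\<in>quadruples M (int X) (int A). cmod (recip_sum B (quotients \<omega>))) ^ (2 * r) \<le>
    real (card (quadruples M (int X) (int A))) ^ (2 * (r - 1)) * N\<^sub>2 *
      (real_of_int p * (real_of_int p * real B ^ r * real r ^ r + 4 * real r * real B ^ (2 * r)))"
proof -
  have fin: "finite M" using M finite_subset by blast
  define \<Omega> where "\<Omega> = quadruples M (int X) (int A)"
  have fin\<Omega>: "finite \<Omega>" unfolding \<Omega>_def by (rule finite_quadruples[OF fin])
  have q\<Omega>: "quotients ` \<Omega> \<subseteq> {0..<p} \<times> {0..<p}" using quotients_in by blast
  let ?F = "\<lambda>s. cmod (recip_sum B s)"
  have "(\<Sum>\<omega>\<in>\<Omega>. ?F (quotients \<omega>)) ^ (2 * r) = ((\<Sum>\<omega>\<in>\<Omega>. ?F (quotients \<omega>)) ^ r)\<^sup>2"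
    by (simp add: power_mult[symmetric] mult.commute)
  also have "\<dots> \<le> (real (card \<Omega>) ^ (r - 1) * (\<Sum>\<omega>\<in>\<Omega>. ?F (quotients \<omega>) ^ r))\<^sup>2"
    by (intro power_mono power_sum_le_card_mult_sum_power r zero_le_power sum_nonneg) auto
  also have "\<dots> = real (card \<Omega>) ^ (2 * (r - 1)) * (\<Sum>\<omega>\<in>\<Omega>. ?F (quotients \<omega>) ^ r)\<^sup>2"
    by (simp only: power_mult_distrib power_mult[symmetric] mult.commute)
  also have "\<dots> \<le> real (card \<Omega>) ^ (2 * (r - 1)) * (N\<^sub>2 * (\<Sum>s\<in>{0..<p}\<times>{0..<p}. (?F s ^ r)\<^sup>2))"
    unfolding N\<^sub>2_def \<Omega>_def[symmetric]
    by (intro mult_left_mono sum_comp_squared_le[OF fin\<Omega> _ q\<Omega>, where f = "\<lambda>s. ?F s ^ r"]) auto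
  also have "(\<Sum>s\<in>{0..<p}\<times>{0..<p}. (?F s ^ r)\<^sup>2)
      = (\<Sum>s\<in>{0..<p}. \<Sum>t\<in>{0..<p}. cmod (\<Sum>b\<in>{1..int B}. e (s * rcp (t + b))) ^ (2 * r))"
    by (simp add: sum.cartesian_product recip_sum_def case_prod_unfold mult.commute flip: power_mult)
  finally have *: "(\<Sum>\<omega>\<in>\<Omega>. ?F (quotients \<omega>)) ^ (2 * r) \<le> real (card \<Omega>) ^ (2 * (r - 1)) *
    (N\<^sub>2 * (\<Sum>s\<in>{0..<p}. \<Sum>t\<in>{0..<p}. cmod (\<Sum>b\<in>{1..int B}. e (s * rcp (t + b))) ^ (2 * r)))" .
  also have "\<dots> \<le> real (card \<Omega>) ^ (2 * (r - 1)) *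
    (N\<^sub>2 * (real_of_int p * (real_of_int p * real B ^ r * real r ^ r + 4 * real r * real B ^ (2 * r))))"
    by (intro mult_left_mono reciprocal_moment B r) (auto simp: N\<^sub>2_def)
  finally show ?thesis by (simp add: \<Omega>_def mult.assoc)
qed

definition weighted_sum :: "(int \<Rightarrow> complex) \<Rightarrow> int set \<Rightarrow> int \<Rightarrow> complex" where
  "weighted_sum \<alpha> M y = (\<Sum>m\<in>M. \<alpha> m * e (m * rcp y))"

lemma norm_weighted_sum_squared:
  assumes "finite M"
  shows "complex_of_real ((cmod (weighted_sum \<alpha> M y))\<^sup>2) =
    (\<Sum>m\<in>M. \<alpha> m * cnj (\<alpha> m)) +
    (\<Sum>\<mu>\<in>off_diagonal M. \<alpha> (fst \<mu>) * cnj (\<alpha> (snd \<mu>)) * e ((fst \<mu> - snd \<mu>) * rcp y))"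
proof -
  let ?f = "\<lambda>\<mu>. \<alpha> (fst \<mu>) * cnj (\<alpha> (snd \<mu>)) * e ((fst \<mu> - snd \<mu>) * rcp y)"
  have "complex_of_real ((cmod (weighted_sum \<alpha> M y))\<^sup>2)
      = (\<Sum>m\<in>M. \<alpha> m * e (m * rcp y)) * (\<Sum>m\<in>M. cnj (\<alpha> m) * e (- (m * rcp y)))"
    by (simp add: complex_norm_square weighted_sum_def cnj_e_mod del: of_real_power)
  also have "\<dots> = (\<Sum>\<mu>\<in>M\<times>M. (\<alpha> (fst \<mu>) * e (fst \<mu> * rcp y)) * (cnj (\<alpha> (snd \<mu>)) * e (- (snd \<mu> * rcp y))))"
    by (simp only: sum_product sum.cartesian_product case_prod_unfold)
  also have "\<dots> = (\<Sum>\<mu>\<in>M\<times>M. ?f \<mu>)"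
  proof (intro sum.cong refl)
    fix \<mu> :: "int \<times> int"
    have "e ((fst \<mu> - snd \<mu>) * rcp y) = e (fst \<mu> * rcp y) * e (- (snd \<mu> * rcp y))"
      unfolding e_mod_add[symmetric] by (simp add: left_diff_distrib)
    thus "(\<alpha> (fst \<mu>) * e (fst \<mu> * rcp y)) * (cnj (\<alpha> (snd \<mu>)) * e (- (snd \<mu> * rcp y))) = ?f \<mu>" by simp
  qed
  also have "\<dots> = (\<Sum>\<mu>\<in>{\<mu>\<in>M\<times>M. fst \<mu> = snd \<mu>}. ?f \<mu>) + (\<Sum>\<mu>\<in>off_diagonal M. ?f \<mu>)"
    unfolding off_diagonal_def using assms
    by (subst sum.union_disjoint[symmetric]) (auto intro!: sum.cong)
  also have "(\<Sum>\<mu>\<in>{\<mu>\<in>M\<times>M. fst \<mu> = snd \<mu>}. ?f \<mu>) = (\<Sum>m\<in>M. \<alpha> m * cnj (\<alpha> m))"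
    by (rule sum.reindex_bij_witness[of _ "\<lambda>m. (m, m)" fst]) auto
  finally show ?thesis .
qed

text \<open>Factoring out \<open>a\<close> writes z + ab as a(z/a + b), and \<open>rcp\<close> is
  multiplicative even where this vanishes modulo \<open>p\<close>; hence no shift has to be
  excluded.\<close>

lemma rcp_shift:
  assumes "\<not> p dvd a"
  shows "[x * rcp (z + a * b) = (x * rcp a mod p) * rcp (z * rcp a mod p + b)] (mod p)"
proof -
  have "[z + a * b = a * (z * rcp a mod p + b)] (mod p)"
  proof -
    have "[a * (z * rcp a mod p + b) = a * (z * rcp a + b)] (mod p)"
      by (intro cong_mult cong_add cong_refl) (simp add: Cong.cong_def)
    also have "a * (z * rcp a + b) = z * (a * rcp a) + a * b" by (simp add: algebra_simps)
    also have "[\<dots> = z * 1 + a * b] (mod p)"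
      by (intro cong_mult cong_add cong_refl rcp_works assms)
    finally show ?thesis by (simp add: cong_sym)
  qed
  hence "[x * rcp (z + a * b) = x * rcp (a * (z * rcp a mod p + b))] (mod p)"
    by (intro cong_mult rcp_cong cong_refl)
  also have "x * rcp (a * (z * rcp a mod p + b)) = x * rcp a * rcp (z * rcp a mod p + b)"
    by (simp add: rcp_mult mult.assoc)
  also have "[\<dots> = (x * rcp a mod p) * rcp (z * rcp a mod p + b)] (mod p)"
    by (intro cong_mult cong_refl) (simp add: Cong.cong_def)
  finally show ?thesis .
qed

text \<open>The square is opened before the sum over \<open>b\<close> is taken, so that
  \<open>b\<close> occurs only in reciprocal sums whose coefficients are products of two weights.
  Absolute values then remove the weights at the cost of \<open>c\<^sup>2\<close>.\<close>

lemma sum_shifted_squares_le: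
  fixes B :: nat
  assumes M: "finite M" and c: "\<And>m. m \<in> M \<Longrightarrow> cmod (\<alpha> m) \<le> c" and a: "\<not> p dvd a"
  shows "(\<Sum>b\<in>{1..int B}. (cmod (weighted_sum \<alpha> M (z + a * b)))\<^sup>2)
    \<le> c\<^sup>2 * (real B * real (card M) + (\<Sum>\<mu>\<in>off_diagonal M. cmod (recip_sum B (quotients (\<mu>, z, a)))))"
proof -
  have off: "cmod (\<alpha> (fst \<mu>) * cnj (\<alpha> (snd \<mu>))) \<le> c\<^sup>2" if "\<mu> \<in> M \<times> M" for \<mu>
    unfolding norm_mult complex_mod_cnj power2_eq_square
    using that c by (intro mult_mono') auto
  have "complex_of_real (\<Sum>b\<in>{1..int B}. (cmod (weighted_sum \<alpha> M (z + a * b)))\<^sup>2)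
    = (\<Sum>b\<in>{1..int B}. (\<Sum>m\<in>M. \<alpha> m * cnj (\<alpha> m)) +
    (\<Sum>\<mu>\<in>off_diagonal M. \<alpha> (fst \<mu>) * cnj (\<alpha> (snd \<mu>)) * e ((fst \<mu> - snd \<mu>) * rcp (z + a * b))))"
    by (simp only: of_real_sum norm_weighted_sum_squared[OF M])
  also have "\<dots> = of_nat B * (\<Sum>m\<in>M. \<alpha> m * cnj (\<alpha> m)) + 
    (\<Sum>b\<in>{1..int B}. \<Sum>\<mu>\<in>off_diagonal M. \<alpha> (fst \<mu>) * cnj (\<alpha> (snd \<mu>)) * e ((fst \<mu> - snd \<mu>) * rcp (z + a * b)))"
    by (simp add: sum.distrib)
  also have "(\<Sum>b\<in>{1..int B}. \<Sum>\<mu>\<in>off_diagonal M. \<alpha> (fst \<mu>) * cnj (\<alpha> (snd \<mu>)) * e ((fst \<mu> - snd \<mu>) * rcp (z + a * b)))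
    = (\<Sum>\<mu>\<in>off_diagonal M. \<Sum>b\<in>{1..int B}. \<alpha> (fst \<mu>) * cnj (\<alpha> (snd \<mu>)) * e ((fst \<mu> - snd \<mu>) * rcp (z + a * b)))"
    by (rule sum.swap)
  also have "\<dots> = (\<Sum>\<mu>\<in>off_diagonal M. \<alpha> (fst \<mu>) * cnj (\<alpha> (snd \<mu>)) * recip_sum B (quotients (\<mu>, z, a)))"
    by (intro sum.cong refl)
       (auto simp: recip_sum_def quotients_def sum_distrib_left intro!: sum.cong e_cong rcp_shift a)
  finally have eq: "complex_of_real (\<Sum>b\<in>{1..int B}. (cmod (weighted_sum \<alpha> M (z + a * b)))\<^sup>2) =
    of_nat B * (\<Sum>m\<in>M. \<alpha> m * cnj (\<alpha> m)) +
    (\<Sum>\<mu>\<in>off_diagonal M. \<alpha> (fst \<mu>) * cnj (\<alpha> (snd \<mu>)) * recip_sum B (quotients (\<mu>, z, a)))" .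
  have "(\<Sum>b\<in>{1..int B}. (cmod (weighted_sum \<alpha> M (z + a * b)))\<^sup>2)
    = cmod (complex_of_real (\<Sum>b\<in>{1..int B}. (cmod (weighted_sum \<alpha> M (z + a * b)))\<^sup>2))"
    unfolding norm_of_real by (rule abs_of_nonneg[symmetric]) (intro sum_nonneg zero_le_power2)
  also have "\<dots> \<le> real B * (\<Sum>m\<in>M. c\<^sup>2) + (\<Sum>\<mu>\<in>off_diagonal M. c\<^sup>2 * cmod (recip_sum B (quotients (\<mu>, z, a))))"
    unfolding eq
  proof (intro norm_triangle_mono)
    have "cmod (\<Sum>m\<in>M. \<alpha> m * cnj (\<alpha> m)) \<le> (\<Sum>m\<in>M. c\<^sup>2)"
      using off[of "(m, m)" for m] by (intro sum_norm_le) auto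
    thus "cmod (of_nat B * (\<Sum>m\<in>M. \<alpha> m * cnj (\<alpha> m))) \<le> real B * (\<Sum>m\<in>M. c\<^sup>2)"
      unfolding norm_mult norm_of_nat by (rule mult_left_mono) simp
    show "cmod (\<Sum>\<mu>\<in>off_diagonal M. \<alpha> (fst \<mu>) * cnj (\<alpha> (snd \<mu>)) * recip_sum B (quotients (\<mu>, z, a)))
      \<le> (\<Sum>\<mu>\<in>off_diagonal M. c\<^sup>2 * cmod (recip_sum B (quotients (\<mu>, z, a))))"
      using off by (intro sum_norm_le) (auto simp: norm_mult[of _ "recip_sum B _"] off_diagonal_def intro!: mult_right_mono)
  qed
  also have "\<dots> = c\<^sup>2 * (real B * real (card M) + (\<Sum>\<mu>\<in>off_diagonal M. cmod (recip_sum B (quotients (\<mu>, z, a)))))"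
    by (simp add: algebra_simps sum_distrib_left)
  finally show ?thesis .
qed

text \<open>
  Every \<open>y\<close> with \<open>\<bar>y\<bar> \<le> X\<close> equals \<open>z + ab\<close> for some \<open>\<bar>z\<bar> \<le> 2X\<close>, whichever \<open>a\<close> and \<open>b\<close> are
  prescribed; the summand being nonnegative, no completion of the range of \<open>z\<close> is needed.
\<close>

lemma sum_squares_shift_le:
  fixes A B X :: nat and g :: "int \<Rightarrow> real"
  assumes AB: "A * B \<le> X" and g: "\<And>y. g y \<ge> 0"
  shows "real A * real B * (\<Sum>y\<in>{- int X..int X}. g y)
    \<le> (\<Sum>z\<in>{- int (2 * X)..int (2 * X)}. \<Sum>a\<in>{1..int A}. \<Sum>b\<in>{1..int B}. g (z + a * b))"
proof -
  have "(\<Sum>y\<in>{- int X..int X}. g y) \<le> (\<Sum>z\<in>{- int (2 * X)..int (2 * X)}. g (z + a * b))"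
    if a: "a \<in> {1..int A}" and b: "b \<in> {1..int B}" for a b
  proof -
    have "a * b \<le> int A * int B" using a b by (intro mult_mono) auto
    also have "\<dots> \<le> int X" using AB by (simp flip: of_nat_mult)
    finally have ab: "0 \<le> a * b" "a * b \<le> int X" using a b by auto
    have "(\<Sum>y\<in>{- int X..int X}. g y) = (\<Sum>z\<in>{- int X - a * b..int X - a * b}. g (z + a * b))"
      by (rule sum.reindex_bij_witness[of _ "\<lambda>z. z + a * b" "\<lambda>y. y - a * b"]) auto
    also have "\<dots> \<le> (\<Sum>z\<in>{- int (2 * X)..int (2 * X)}. g (z + a * b))"
      using ab g by (intro sum_mono2) auto
    finally show ?thesis .
  qed
  hence "(\<Sum>a\<in>{1..int A}. \<Sum>b\<in>{1..int B}. \<Sum>y\<in>{- int X..int X}. g y)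
    \<le> (\<Sum>a\<in>{1..int A}. \<Sum>b\<in>{1..int B}. \<Sum>z\<in>{- int (2 * X)..int (2 * X)}. g (z + a * b))"
    by (intro sum_mono)
  also have "\<dots> = (\<Sum>a\<in>{1..int A}. \<Sum>z\<in>{- int (2 * X)..int (2 * X)}. \<Sum>b\<in>{1..int B}. g (z + a * b))"
    by (intro sum.cong refl sum.swap)
  also have "\<dots> = (\<Sum>z\<in>{- int (2 * X)..int (2 * X)}. \<Sum>a\<in>{1..int A}. \<Sum>b\<in>{1..int B}. g (z + a * b))"
    by (rule sum.swap)
  finally show ?thesis by (simp add: mult.assoc)
qed

lemma mean_square_weighted_sum_le:
  fixes A B X :: nat
  assumes M: "finite M" and c: "\<And>m. m \<in> M \<Longrightarrow> cmod (\<alpha> m) \<le> c"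
    and A: "int A < p" and AB: "A * B \<le> X"
  shows "real A * real B * (\<Sum>y\<in>{- int X..int X}. (cmod (weighted_sum \<alpha> M y))\<^sup>2)
    \<le> c\<^sup>2 * (real A * real B * (4 * real X + 1) * real (card M)
       + (\<Sum>\<omega>\<in>quadruples M (int (2 * X)) (int A). cmod (recip_sum B (quotients \<omega>))))"
proof -
  let ?Z = "{- int (2 * X)..int (2 * X)}"
  let ?F = "\<lambda>\<omega>. cmod (recip_sum B (quotients \<omega>))"
  have "real A * real B * (\<Sum>y\<in>{- int X..int X}. (cmod (weighted_sum \<alpha> M y))\<^sup>2)
    \<le> (\<Sum>z\<in>?Z. \<Sum>a\<in>{1..int A}. \<Sum>b\<in>{1..int B}. (cmod (weighted_sum \<alpha> M (z + a * b)))\<^sup>2)"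
    by (rule sum_squares_shift_le[OF AB]) simp
  also have "\<dots> \<le> (\<Sum>z\<in>?Z. \<Sum>a\<in>{1..int A}. c\<^sup>2 * (real B * real (card M) + (\<Sum>\<mu>\<in>off_diagonal M. ?F (\<mu>, z, a))))"
    using A by (intro sum_mono sum_shifted_squares_le[OF M c] not_dvd_unit) auto
  also have "\<dots> = c\<^sup>2 * ((\<Sum>z\<in>?Z. \<Sum>a\<in>{1..int A}. real B * real (card M)) +
      (\<Sum>z\<in>?Z. \<Sum>a\<in>{1..int A}. \<Sum>\<mu>\<in>off_diagonal M. ?F (\<mu>, z, a)))"
    by (simp only: sum.distrib sum_distrib_left distrib_left)
  also have "(\<Sum>z\<in>?Z. \<Sum>a\<in>{1..int A}. real B * real (card M)) = real A * real B * (4 * real X + 1) * real (card M)"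
    by (simp add: algebra_simps)
  also have "(\<Sum>z\<in>?Z. \<Sum>a\<in>{1..int A}. \<Sum>\<mu>\<in>off_diagonal M. ?F (\<mu>, z, a)) = (\<Sum>\<omega>\<in>quadruples M (int (2 * X)) (int A). ?F \<omega>)"
  proof -
    have "(\<Sum>z\<in>?Z. \<Sum>a\<in>{1..int A}. \<Sum>\<mu>\<in>off_diagonal M. ?F (\<mu>, z, a))
      = (\<Sum>za\<in>?Z\<times>{1..int A}. \<Sum>\<mu>\<in>off_diagonal M. ?F (\<mu>, za))"
      using sum.cartesian_product[of "\<lambda>z a. \<Sum>\<mu>\<in>off_diagonal M. ?F (\<mu>, z, a)" "{1..int A}" ?Z]
      by (simp only: case_prod_unfold prod.collapse)
    also have "\<dots> = (\<Sum>\<mu>\<in>off_diagonal M. \<Sum>za\<in>?Z\<times>{1..int A}. ?F (\<mu>, za))"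
      by (rule sum.swap)
    also have "\<dots> = (\<Sum>\<omega>\<in>quadruples M (int (2 * X)) (int A). ?F \<omega>)"
      by (simp add: quadruples_def sum.cartesian_product case_prod_unfold)
    finally show ?thesis .
  qed
  finally show ?thesis .
qed

end

section \<open>Extracting roots: from the moment to the mean of the weighted sum\<close>

lemma le_mult_powr_if_power_le:
  fixes x D w :: real
  assumes "x ^ n \<le> D ^ n * w" "D \<ge> 0" "w \<ge> 0" "n \<ge> 1"
  shows "x \<le> D * w powr (1 / real n)"
proof -
  have "(D * w powr (1 / real n)) ^ n = D ^ n * (w powr (1 / real n)) ^ n"
    by (rule power_mult_distrib)
  also have "(w powr (1 / real n)) ^ n = w"
    using assms by (cases "w = 0") (simp_all add: powr_realpow[symmetric] powr_powr power_0_left)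
  finally have "x ^ n \<le> (D * w powr (1 / real n)) ^ n" using assms by simp
  thus ?thesis
    using assms by (cases n) (auto intro: power_le_imp_le_base)
qed

context odd_prime
begin

text \<open>The factor 5 X A B m^2 is the trivial bound; the power with exponent 1/(2r) is the
  saving. In \<open>K\<close>, 1024 comes from the coincidence count, (2r)^r from equal multisets
  and 4r from all other pairs of tuples.\<close>

lemma quadruple_sum_le:
  fixes A B X r :: nat
  assumes M: "M \<subseteq> {0..<p}" and m1: "card M \<ge> 1" and A: "A \<ge> 1" "int A < p" and X: "A \<le> X"
    and B: "int B < p" "real_of_int p \<le> (2 * real B) ^ r" and r: "r \<ge> 1" "int r < p"
  defines "m \<equiv> real (card M)" and "q \<equiv> real_of_int p" and "K \<equiv> 1024 * (real (2 * r) ^ r + 4 * real r)"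
  shows "(\<Sum>\<omega>\<in>quadruples M (int (2 * X)) (int A). cmod (recip_sum B (quotients \<omega>)))
    \<le> 5 * real X * real A * real B * m\<^sup>2 *
      (K * (2 * (1 + ln q)) * (1 / q + 1 / (real A * sqrt m) + q / (real A * real X * m))) powr (1 / (2 * real r))"
proof -
  define a b x where "a = real A" and "b = real B" and "x = real X"
  define L where "L = 2 * (1 + ln q)"
  \<comment> \<open>The coincidence bound divided by a^2 x^2 m^4 / q, up to constant and logarithm.
    The remaining 1/q cancels the factor \<open>q\<close> in front of the moment.\<close>
  define \<tau> where "\<tau> = 1 / q + 1 / (a * sqrt m) + q / (a * x * m)"
  define Q where "Q = (\<Sum>\<omega>\<in>quadruples M (int (2 * X)) (int A). cmod (recip_sum B (quotients \<omega>)))"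
  define N\<^sub>2 where "N\<^sub>2 = real (card {(\<omega>, \<omega>'). \<omega> \<in> quadruples M (int (2 * X)) (int A) \<and>
    \<omega>' \<in> quadruples M (int (2 * X)) (int A) \<and> quotients \<omega> = quotients \<omega>'})"
  have fin: "finite M" using M finite_subset by blast
  have pos: "1 \<le> a" "a \<le> x" "a \<le> q" "1 \<le> m" "q > 1" "b \<ge> 0" "r \<ge> 1" "1 \<le> x"
    using A X m1 gt2 r by (auto simp: a_def x_def m_def q_def b_def)
  have L: "L \<ge> 1" "2 * (1 + ln a) \<le> L" using pos by (auto simp: L_def)
  have \<tau>: "\<tau> \<ge> 0" using pos by (simp add: \<tau>_def)
  have "N\<^sub>2 \<le> 256 * a ^ 2 * (2 * x) ^ 2 / q ^ 2 * m ^ 4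
       + 128 * a * (2 * x) ^ 2 / q * (m ^ 3 * sqrt m * (2 * (1 + ln a))) + 16 * a * (2 * x) * (m ^ 3 * (2 * (1 + ln a)))"
    using quotient_coincidences_le[OF M A, of "2 * X"] X
    by (simp add: N\<^sub>2_def a_def x_def m_def q_def)
  also have "\<dots> \<le> 256 * a ^ 2 * (2 * x) ^ 2 / q ^ 2 * (m ^ 4 * L)
       + 128 * a * (2 * x) ^ 2 / q * (m ^ 3 * sqrt m * L) + 16 * a * (2 * x) * (m ^ 3 * L)"
    using pos L mult_left_mono[of 1 L "m ^ 4"] by (intro add_mono mult_left_mono) auto
  \<comment> \<open>The constants are 256 * 4, 128 * 4 and 16 * 2, the doubled range of z included;
    1024 is the largest.\<close>
  also have "\<dots> \<le> 1024 * a ^ 2 * x ^ 2 / q ^ 2 * (m ^ 4 * L)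
       + 1024 * a * x ^ 2 / q * (m ^ 3 * sqrt m * L) + 1024 * a * x * (m ^ 3 * L)"
    using pos L by (intro add_mono mult_right_mono divide_right_mono) auto
  also have "\<dots> = 1024 * L * (a\<^sup>2 * x\<^sup>2 * m ^ 4 / q) * \<tau>"
  proof -
    have "m ^ 3 * sqrt m = m ^ 4 / sqrt m"
    proof -
      have "m ^ 3 * sqrt m * sqrt m = m ^ 4" using pos by (simp add: mult.assoc eval_nat_numeral)
      thus ?thesis using pos by (simp add: eq_divide_eq)
    qed
    moreover have "m ^ 3 = m ^ 4 / m" using pos by (simp add: eval_nat_numeral)
    ultimately show ?thesis using pos
      by (simp add: \<tau>_def distrib_left power2_eq_square, simp add: mult_ac)
  qed
  finally have N2: "N\<^sub>2 \<le> 1024 * L * (a\<^sup>2 * x\<^sup>2 * m ^ 4 / q) * \<tau>" .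
  have card: "real (card (quadruples M (int (2 * X)) (int A))) \<le> 5 * x * a * m\<^sup>2"
  proof -
    have "card (quadruples M (int (2 * X)) (int A)) = card (off_diagonal M) * ((4 * X + 1) * A)"
      by (simp add: quadruples_def card_cartesian_product nat_add_distrib nat_mult_distrib)
    also have "\<dots> \<le> card M ^ 2 * ((5 * X) * A)"
      using X A by (intro mult_mono card_off_diagonal_le[OF fin]) auto
    finally have "real (card (quadruples M (int (2 * X)) (int A))) \<le> real (card M ^ 2 * ((5 * X) * A))"
      by (rule of_nat_mono)
    thus ?thesis by (simp add: x_def a_def m_def mult_ac)
  qed
  have moment: "q * (q * b ^ r * real r ^ r + 4 * real r * b ^ (2 * r)) \<le> q * (b ^ (2 * r) * (real (2 * r) ^ r + 4 * real r))"
  proof -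
    \<comment> \<open>The condition \<open>q \<le> (2 * b) ^ r\<close> brings the multiset term down
      to the size b^(2r) of the other one.\<close>
    have "q * b ^ r * real r ^ r \<le> (2 * b) ^ r * b ^ r * real r ^ r"
      using B pos by (intro mult_right_mono) (auto simp: q_def b_def)
    also have "\<dots> = b ^ (2 * r) * real (2 * r) ^ r"
    proof -
      have "b ^ (2 * r) = b ^ r * b ^ r" by (simp only: mult_2 power_add)
      thus ?thesis by (simp add: power_mult_distrib mult_ac)
    qed
    finally show ?thesis using pos by (intro mult_left_mono) (auto simp: algebra_simps)
  qed
  have "Q ^ (2 * r) \<le> real (card (quadruples M (int (2 * X)) (int A))) ^ (2 * (r - 1)) * N\<^sub>2 *
      (q * (q * b ^ r * real r ^ r + 4 * real r * b ^ (2 * r)))"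
    unfolding Q_def N\<^sub>2_def q_def b_def
    using X by (intro quadruple_sum_power_le M A B r) auto
  also have "\<dots> \<le> (5 * x * a * m\<^sup>2) ^ (2 * (r - 1)) * (1024 * L * (a\<^sup>2 * x\<^sup>2 * m ^ 4 / q) * \<tau>) *
      (q * (b ^ (2 * r) * (real (2 * r) ^ r + 4 * real r)))"
    using pos L \<tau> by (intro mult_mono power_mono card N2 moment mult_nonneg_nonneg add_nonneg_nonneg) (auto simp: N\<^sub>2_def)
  also have "\<dots> = (5 * x * a * m\<^sup>2) ^ (2 * (r - 1)) * (x * a * m\<^sup>2)\<^sup>2 * b ^ (2 * r) * (K * L * \<tau>)"
    using pos by (simp add: K_def power_mult_distrib eval_nat_numeral)
  also have "\<dots> \<le> (5 * x * a * m\<^sup>2) ^ (2 * (r - 1)) * (5 * x * a * m\<^sup>2)\<^sup>2 * b ^ (2 * r) * (K * L * \<tau>)"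
    using pos L \<tau> by (intro mult_right_mono mult_left_mono power_mono) (auto simp: K_def)
  also have "\<dots> = (5 * x * a * b * m\<^sup>2) ^ (2 * r) * (K * L * \<tau>)"
  proof -
    have "(5 * x * a * m\<^sup>2) ^ (2 * (r - 1)) * (5 * x * a * m\<^sup>2)\<^sup>2 = (5 * x * a * m\<^sup>2) ^ (2 * r)"
    proof -
      have "2 * r = 2 * (r - 1) + 2" using pos by simp
      thus ?thesis by (simp only: power_add)
    qed
    moreover have "5 * x * a * b * m\<^sup>2 = (5 * x * a * m\<^sup>2) * b" by simp
    ultimately show ?thesis by (simp only: power_mult_distrib)
  qed
  finally have "Q \<le> 5 * x * a * b * m\<^sup>2 * (K * L * \<tau>) powr (1 / real (2 * r))"
    using pos L \<tau> by (intro le_mult_powr_if_power_le) (auto simp: K_def)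
  thus ?thesis by (simp add: Q_def x_def a_def b_def L_def \<tau>_def)
qed

text \<open>Cauchy-Schwarz over the at most 3X points halves the exponent 1/(2r) of the mean square.
  The constant 4 comes from 5 * 3 \<le> 4^2. The term sqrt m is the diagonal, the other one the
  off-diagonal pairs.\<close>

lemma sum_norm_weighted_sum_le:
  fixes A B X r :: nat
  assumes M: "M \<subseteq> {0..<p}" and m1: "card M \<ge> 1" and c: "\<And>m. m \<in> M \<Longrightarrow> cmod (\<alpha> m) \<le> c"
    and A: "A \<ge> 1" "int A < p" and AB: "A * B \<le> X" "B \<ge> 1"
    and B: "int B < p" "real_of_int p \<le> (2 * real B) ^ r" and r: "r \<ge> 1" "int r < p"
  defines "m \<equiv> real (card M)" and "q \<equiv> real_of_int p" and "K \<equiv> 1024 * (real (2 * r) ^ r + 4 * real r)"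
  shows "(\<Sum>y\<in>{- int X..int X}. cmod (weighted_sum \<alpha> M y))
    \<le> 4 * c * real X * (sqrt m + m *
      (K * (2 * (1 + ln q)) * (1 / q + 1 / (real A * sqrt m) + q / (real A * real X * m))) powr (1 / (4 * real r)))"
proof -
  have fin: "finite M" using M finite_subset by blast
  have "A * 1 \<le> X" using mult_le_mono2[OF AB(2)] AB(1) by (rule order_trans)
  hence AX: "A \<le> X" by simp
  define W where "W = K * (2 * (1 + ln q)) * (1 / q + 1 / (real A * sqrt m) + q / (real A * real X * m))"
  define U where "U = (\<Sum>y\<in>{- int X..int X}. (cmod (weighted_sum \<alpha> M y))\<^sup>2)"
  define w where "w = W powr (1 / (4 * real r))"
  have q: "q > 1" using gt2 by (simp add: q_def)
  have W: "W \<ge> 0" using q by (auto simp: W_def K_def m_def intro!: mult_nonneg_nonneg add_nonneg_nonneg)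
  have w: "w \<ge> 0" "w\<^sup>2 = W powr (1 / (2 * real r))"
    by (auto simp: w_def powr_half_sqrt power2_eq_square simp flip: powr_add)
  have m: "m \<ge> 1" using m1 by (simp add: m_def)
  have c0: "c \<ge> 0"
  proof -
    obtain k where "k \<in> M" using m1 by fastforce
    thus ?thesis using c[of k] norm_ge_zero order_trans by blast
  qed
  have X1: "X \<ge> 1" using AX A by simp
  have "real A * real B * U \<le> c\<^sup>2 * (real A * real B * (4 * real X + 1) * m
       + (\<Sum>\<omega>\<in>quadruples M (int (2 * X)) (int A). cmod (recip_sum B (quotients \<omega>))))"
    unfolding U_def m_def by (rule mean_square_weighted_sum_le[OF fin c A(2) AB(1)])
  also have "\<dots> \<le> c\<^sup>2 * (real A * real B * (5 * real X) * m
       + 5 * real X * real A * real B * m\<^sup>2 * w\<^sup>2)"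
    unfolding w(2) W_def m_def q_def K_def
    using X1 m by (intro mult_left_mono add_mono mult_right_mono quadruple_sum_le M m1 A AX B r) auto
  also have "\<dots> = real A * real B * (5 * c\<^sup>2 * real X * (m + m\<^sup>2 * w\<^sup>2))"
    by (simp add: algebra_simps)
  finally have U: "U \<le> 5 * c\<^sup>2 * real X * (m + m\<^sup>2 * w\<^sup>2)"
    using A(1) AB(2) by (subst (asm) mult_le_cancel_left_pos) auto
  have "(\<Sum>y\<in>{- int X..int X}. cmod (weighted_sum \<alpha> M y))\<^sup>2 \<le> U * real (card {- int X..int X})"
    unfolding U_def by (rule sum_squared_le_sum_of_squares)
  also have "\<dots> \<le> (5 * c\<^sup>2 * real X * (m + m\<^sup>2 * w\<^sup>2)) * (3 * real X)"
    using U X1 m by (intro mult_mono) (auto intro!: mult_nonneg_nonneg add_nonneg_nonneg)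
  also have "\<dots> \<le> (4 * c * real X)\<^sup>2 * (m + m\<^sup>2 * w\<^sup>2)"
  proof -
    define E where "E = c\<^sup>2 * (real X)\<^sup>2 * (m + m\<^sup>2 * w\<^sup>2)"
    have "E \<ge> 0" using m by (simp add: E_def)
    moreover have "(5 * c\<^sup>2 * real X * (m + m\<^sup>2 * w\<^sup>2)) * (3 * real X) = 15 * E"
      by (simp add: E_def power2_eq_square)
    moreover have "(4 * c * real X)\<^sup>2 * (m + m\<^sup>2 * w\<^sup>2) = 16 * E"
      by (simp add: E_def power_mult_distrib)
    ultimately show ?thesis by linarith
  qed
  also have "\<dots> \<le> (4 * c * real X)\<^sup>2 * (sqrt m + m * w)\<^sup>2"
    using m w by (intro mult_left_mono) (auto simp: power2_sum power_mult_distrib)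
  finally have "(\<Sum>y\<in>{- int X..int X}. cmod (weighted_sum \<alpha> M y))\<^sup>2 \<le> (4 * c * real X * (sqrt m + m * w))\<^sup>2"
    by (simp only: power_mult_distrib)
  thus ?thesis unfolding w_def W_def
    by (rule power2_le_imp_le) (use c0 m in auto)
qed

end

section \<open>Dyadic decomposition and the final bound\<close>

text \<open>A weak form of Jordan's inequality: x - x^3/6 is at least x/2 as soon as x^2 \<le> 3,
  and pi/2 is below 8/5.\<close>

lemma sin_ge_half:
  fixes x :: real
  assumes "0 \<le> x" "x \<le> pi / 2"
  shows "x / 2 \<le> sin x"
proof -
  have "\<bar>sin x - (\<Sum>m<3. sin_coeff m * x ^ m)\<bar> \<le> inverse (fact 3) * \<bar>x\<bar> ^ 3"
    by (rule Maclaurin_sin_bound)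
  hence "\<bar>sin x - x\<bar> \<le> x ^ 3 / 6"
    using assms by (simp add: eval_nat_numeral sin_coeff_def fact_numeral)
  hence "x - x ^ 3 / 6 \<le> sin x" by linarith
  moreover have "x ^ 3 \<le> 3 * x"
  proof -
    have "x \<le> 8 / 5" using assms pi_less_4 pi_approx by simp
    hence "x * x \<le> 8 / 5 * (8 / 5)" using assms by (intro mult_mono) auto
    hence "x * x * x \<le> 3 * x" using assms by (intro mult_right_mono) auto
    thus ?thesis by (simp add: power3_eq_cube)
  qed
  ultimately show ?thesis by simp
qed

lemma norm_cis_minus_1: "cmod (cis (2 * x) - 1) = 2 * \<bar>sin x\<bar>"
proof -
  have "cis (2 * x) - 1 = cis x * (2 * \<i> * of_real (sin x))"
    by (auto simp: complex_eq_iff cos_double_sin sin_double power2_eq_square)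
  thus ?thesis by (simp add: norm_mult)
qed

section \<open>Exponential sums over intervals and dyadic scales\<close>

context odd_prime
begin

lemma norm_e_minus_1_ge:
  assumes "2 * \<bar>y\<bar> < p"
  shows "2 * \<bar>real_of_int y\<bar> / real_of_int p \<le> cmod (e y - 1)"
proof -
  define t where "t = pi * real_of_int \<bar>y\<bar> / real_of_int p"
  have "2 * real_of_int \<bar>y\<bar> \<le> real_of_int p" using assms by linarith
  hence t: "0 \<le> t" "t \<le> pi / 2" using p_pos by (simp_all add: t_def field_simps)
  have "cmod (e y - 1) = 2 * \<bar>sin (pi * real_of_int y / real_of_int p)\<bar>"
    using norm_cis_minus_1[of "pi * real_of_int y / real_of_int p"] by (simp add: e_mod_cis mult.assoc)
  also have "\<bar>sin (pi * real_of_int y / real_of_int p)\<bar> = sin t"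
  proof -
    have "sin t \<ge> 0" by (rule sin_ge_zero) (use t pi_gt_zero in linarith)+
    thus ?thesis by (cases "y \<ge> 0") (simp_all add: t_def)
  qed
  finally have "t \<le> cmod (e y - 1)" using sin_ge_half[OF t] by simp
  moreover have "2 * \<bar>real_of_int y\<bar> / real_of_int p \<le> t"
    unfolding t_def using mult_right_mono[OF pi_ge_two, of "\<bar>real_of_int y\<bar>"] p_pos
    by (intro divide_right_mono) auto
  ultimately show ?thesis by simp
qed

lemma sum_e_interval_le:
  assumes J: "is_residue_interval p N J" and N: "real N \<le> real_of_int p"
  shows "cmod (\<Sum>n\<in>J. e (n * y)) \<le> real N"
    and "2 * \<bar>y\<bar> < p \<Longrightarrow> y \<noteq> 0 \<Longrightarrow> cmod (\<Sum>n\<in>J. e (n * y)) \<le> real_of_int p / \<bar>real_of_int y\<bar>"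
proof -
  obtain N0 where J: "J = (\<lambda>k. k mod p) ` {N0 + 1..N0 + int N}"
    using J by (auto simp: is_residue_interval_def)
  have Np: "int N \<le> p" using N by linarith
  \<comment> \<open>The sum over the set \<open>J\<close> counts each residue once; it equals the
    geometric series over consecutive integers because \<open>N \<le> p\<close> keeps their residues
    distinct.\<close>
  have inj: "inj_on (\<lambda>k. k mod p) {N0 + 1..N0 + int N}"
  proof
    fix k l assume kl: "k \<in> {N0 + 1..N0 + int N}" "l \<in> {N0 + 1..N0 + int N}" "k mod p = l mod p"
    hence "p dvd k - l" by (simp add: mod_eq_dvd_iff)
    moreover have "\<bar>k - l\<bar> < p" using kl Np by auto
    ultimately have "k - l = 0" using dvd_imp_le_int[of "k - l" p] by linarith
    thus "k = l" by simp
  qed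
  have "(\<Sum>n\<in>J. e (n * y)) = (\<Sum>k\<in>{N0 + 1..N0 + int N}. e (k mod p * y))"
    unfolding J using inj by (simp add: sum.reindex)
  also have "\<dots> = (\<Sum>k\<in>{N0 + 1..N0 + int N}. e (k * y))"
    by (intro sum.cong refl e_cong cong_mult) (auto simp: Cong.cong_def)
  also have "\<dots> = (\<Sum>i<N. e ((N0 + 1 + int i) * y))"
    by (rule sum.reindex_bij_witness[of _ "\<lambda>i. N0 + 1 + int i" "\<lambda>k. nat (k - N0 - 1)"]) auto
  also have "\<dots> = e ((N0 + 1) * y) * (\<Sum>i<N. e y ^ i)"
    by (simp add: sum_distrib_left e_mod_power distrib_right e_mod_add)
  finally have eq: "(\<Sum>n\<in>J. e (n * y)) = e ((N0 + 1) * y) * (\<Sum>i<N. e y ^ i)" .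
  have "cmod (\<Sum>i<N. e y ^ i) \<le> (\<Sum>i<N. 1)"
    by (intro sum_norm_le) (simp add: norm_power)
  thus "cmod (\<Sum>n\<in>J. e (n * y)) \<le> real N" by (simp add: eq norm_mult)
  assume y: "2 * \<bar>y\<bar> < p" "y \<noteq> 0"
  have ge: "2 * \<bar>real_of_int y\<bar> / real_of_int p \<le> cmod (e y - 1)" by (rule norm_e_minus_1_ge[OF y(1)])
  have pos: "2 * \<bar>real_of_int y\<bar> / real_of_int p > 0" using y p_pos by simp
  hence ne: "e y \<noteq> 1" using ge by auto
  have "cmod (\<Sum>n\<in>J. e (n * y)) = cmod (e y ^ N - 1) / cmod (e y - 1)"
    using ne by (simp add: eq norm_mult geometric_sum norm_divide)
  also have "\<dots> \<le> 2 / (2 * \<bar>real_of_int y\<bar> / real_of_int p)"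
  proof (rule frac_le)
    have "cmod (e y ^ N - 1) \<le> cmod (e y ^ N) + cmod 1" by (rule norm_triangle_ineq4)
    thus "cmod (e y ^ N - 1) \<le> 2" by (simp add: norm_power)
  qed (use pos ge in auto)
  finally show "cmod (\<Sum>n\<in>J. e (n * y)) \<le> real_of_int p / \<bar>real_of_int y\<bar>" by simp
qed

text \<open>The representatives of least absolute value of the nonzero residues; for them the
  distance of y/p to the nearest integer is |y|/p.\<close>

definition centred :: "int set" where "centred = {y. y \<noteq> 0 \<and> 2 * \<bar>y\<bar> < p}"

lemma finite_centred: "finite centred"
  by (rule finite_subset[of _ "{-p..p}"]) (auto simp: centred_def)

lemma rcp_bij_betw_centred: "bij_betw (\<lambda>y. rcp y mod p) centred {1..<p}"
proof -
  have centred_cong: "x = y" if "x \<in> centred" "y \<in> centred" "[x = y] (mod p)" for x y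
  proof -
    have "p dvd x - y" "\<bar>x - y\<bar> < p" using that by (auto simp: centred_def cong_iff_dvd_diff)
    thus ?thesis using dvd_imp_le_int[of "x - y" p] by fastforce
  qed
  have "inj_on (\<lambda>y. rcp y mod p) centred"
    using centred_cong rcp_inj by (auto simp: inj_on_def Cong.cong_def)
  moreover have "(\<lambda>y. rcp y mod p) ` centred \<subseteq> {1..<p}"
  proof (rule image_subsetI)
    fix y assume y: "y \<in> centred"
    hence "\<not> p dvd y" using dvd_imp_le_int[of y p] by (auto simp: centred_def)
    hence "rcp y mod p \<noteq> 0" using rcp_dvd_iff by (simp add: dvd_eq_mod_eq_0)
    moreover have "0 \<le> rcp y mod p" "rcp y mod p < p" using p_pos by simp_all
    ultimately show "rcp y mod p \<in> {1..<p}" by auto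
  qed
  moreover have "{1..<p} \<subseteq> (\<lambda>y. rcp y mod p) ` centred"
  proof
    fix x assume x: "x \<in> {1..<p}"
    define z where "z = rcp x mod p"
    define y where "y = (if 2 * z < p then z else z - p)"
    have odd: "odd p" using prime gt2 prime_odd_int by auto
    have "\<not> p dvd rcp x" using rcp_dvd_iff not_dvd_unit[OF x] by simp
    hence "z \<noteq> 0" by (simp add: z_def dvd_eq_mod_eq_0)
    moreover have z: "0 \<le> z" "z < p" using p_pos by (simp_all add: z_def)
    moreover have "2 * z \<noteq> p" using odd by auto
    ultimately have "y \<in> centred" by (auto simp: centred_def y_def)
    moreover have "[y = rcp x] (mod p)" by (simp add: y_def z_def Cong.cong_def)
    hence "[rcp y = x] (mod p)" using rcp_cong rcp_rcp cong_trans by blast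
    hence "rcp y mod p = x" using x by (simp add: Cong.cong_def)
    ultimately show "x \<in> (\<lambda>y. rcp y mod p) ` centred" by blast
  qed
  ultimately show ?thesis by (simp add: bij_betw_def subset_antisym)
qed

lemma kloosterman_centred: "kloosterman p m n = (\<Sum>y\<in>centred. e (m * rcp y) * e (n * y))"
proof -
  have "kloosterman p m n = (\<Sum>y\<in>centred. e (m * (rcp y mod p) + n * rcp (rcp y mod p)))"
    unfolding kloosterman_rcp by (rule sum.reindex_bij_betw[OF rcp_bij_betw_centred, symmetric])
  also have "\<dots> = (\<Sum>y\<in>centred. e (m * rcp y + n * y))"
  proof (intro sum.cong refl e_cong cong_add cong_mult)
    fix y
    show "[rcp y mod p = rcp y] (mod p)" by (simp add: Cong.cong_def)
    hence "[rcp (rcp y mod p) = rcp (rcp y)] (mod p)" by (rule rcp_cong)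
    thus "[rcp (rcp y mod p) = y] (mod p)" using rcp_rcp by (rule cong_trans)
  qed simp_all
  finally show ?thesis by (simp add: e_mod_add)
qed

lemma bilinear_sum_eq:
  "(\<Sum>m\<in>M. \<Sum>n\<in>J. \<alpha> m * kloosterman p m n) = (\<Sum>y\<in>centred. weighted_sum \<alpha> M y * (\<Sum>n\<in>J. e (n * y)))"
proof -
  have "(\<Sum>m\<in>M. \<Sum>n\<in>J. \<alpha> m * kloosterman p m n)
     = (\<Sum>m\<in>M. \<Sum>n\<in>J. \<Sum>y\<in>centred. \<alpha> m * e (m * rcp y) * e (n * y))"
    by (simp add: kloosterman_centred sum_distrib_left mult.assoc)
  also have "\<dots> = (\<Sum>m\<in>M. \<Sum>y\<in>centred. \<Sum>n\<in>J. \<alpha> m * e (m * rcp y) * e (n * y))"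
    by (intro sum.cong refl sum.swap)
  also have "\<dots> = (\<Sum>y\<in>centred. \<Sum>m\<in>M. \<Sum>n\<in>J. \<alpha> m * e (m * rcp y) * e (n * y))"
    by (rule sum.swap)
  finally show ?thesis by (simp only: weighted_sum_def sum_product)
qed

text \<open>For |y| \<le> h the trivial bound \<open>N\<close> serves with j = 0. Otherwise take the
  least j with |y| \<le> 2^j h: minimality gives |y| > 2^(j-1) h, which turns p/|y| \<le> N h/|y|
  into 2N/2^j and keeps 2^j h < 2|y| < p.\<close>

lemma obtain_dyadic_scale:
  assumes J: "is_residue_interval p N J" and N: "N \<ge> 1" "real N \<le> real_of_int p" and y: "y \<in> centred"
    and h: "h \<ge> 1" "real_of_int p \<le> real N * real h" "int h \<le> p"
  obtains j where "int (2 ^ j * h) \<le> p" "\<bar>y\<bar> \<le> int (2 ^ j * h)"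
    "cmod (\<Sum>n\<in>J. e (n * y)) \<le> 2 * real N / 2 ^ j"
proof (cases "\<bar>y\<bar> \<le> int h")
  case True
  thus ?thesis using h sum_e_interval_le(1)[OF J N(2), of y] by (intro that[of 0]) auto
next
  case False
  have yp: "2 * \<bar>y\<bar> < p" "y \<noteq> 0" using y by (auto simp: centred_def)
  define j where "j = (LEAST j. \<bar>y\<bar> \<le> int (2 ^ j * h))"
  have "\<bar>y\<bar> \<le> int (2 ^ nat \<bar>y\<bar> * h)"
  proof -
    have "nat \<bar>y\<bar> * 1 \<le> 2 ^ nat \<bar>y\<bar> * h"
      by (rule mult_le_mono[OF less_imp_le[OF less_exp] h(1)])
    hence "nat \<bar>y\<bar> \<le> 2 ^ nat \<bar>y\<bar> * h" by simp
    thus ?thesis by (simp only: nat_le_iff)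
  qed
  hence j: "\<bar>y\<bar> \<le> int (2 ^ j * h)" unfolding j_def by (rule LeastI)
  have "j \<noteq> 0" using j False by (intro notI) simp
  then obtain i where i: "j = Suc i" by (cases j) auto
  have "i < (LEAST j. \<bar>y\<bar> \<le> int (2 ^ j * h))" unfolding j_def[symmetric] by (simp add: i)
  hence "\<not> \<bar>y\<bar> \<le> int (2 ^ i * h)" by (rule not_less_Least)
  hence lt: "int (2 ^ i * h) < \<bar>y\<bar>" by simp
  show ?thesis
  proof (rule that[of j])
    show "int (2 ^ j * h) \<le> p" using lt yp by (simp add: i)
    show "\<bar>y\<bar> \<le> int (2 ^ j * h)" by (rule j)
    have "real_of_int (int (2 ^ i * h)) \<le> real_of_int \<bar>y\<bar>" using lt by linarith
    hence ylb: "2 ^ i * real h \<le> \<bar>real_of_int y\<bar>" by simp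
    have "cmod (\<Sum>n\<in>J. e (n * y)) \<le> real_of_int p / \<bar>real_of_int y\<bar>"
      by (rule sum_e_interval_le(2)[OF J N(2) yp])
    also have "\<dots> \<le> real N * real h / (2 ^ i * real h)"
      using h ylb N by (intro frac_le) auto
    also have "\<dots> = 2 * real N / 2 ^ j" using h by (simp add: i)
    finally show "cmod (\<Sum>n\<in>J. e (n * y)) \<le> 2 * real N / 2 ^ j" .
  qed
qed

text \<open>At the scale X = 2^j h the kernel is at most 2N/2^j while the weighted sums total at
  most X D, so the powers of 2 cancel. Every scale contributes the same amount, and there are at
  most 1 + log2 p of them.\<close>

lemma bilinear_sum_dyadic_le:
  assumes J: "is_residue_interval p N J" and N: "N \<ge> 1" "real N \<le> real_of_int p" 
    and h: "h \<ge> 1" "real_of_int p \<le> real N * real h" "int h \<le> p"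
    and D: "\<And>X. h \<le> X \<Longrightarrow> int X \<le> p \<Longrightarrow> (\<Sum>y\<in>{- int X..int X}. cmod (weighted_sum \<alpha> M y)) \<le> real X * D"
    and D0: "D \<ge> 0"
  shows "cmod (\<Sum>m\<in>M. \<Sum>n\<in>J. \<alpha> m * kloosterman p m n) \<le> (1 + log 2 (real_of_int p)) * (2 * real N * real h * D)"
proof -
  define S where "S = {j. int (2 ^ j * h) \<le> p}"
  have S: "S \<subseteq> {..nat \<lfloor>log 2 (real_of_int p)\<rfloor>}"
  proof
    fix j assume "j \<in> S"
    hence "real_of_int (int (2 ^ j * h)) \<le> real_of_int p" unfolding S_def by (simp only: of_int_le_iff mem_Collect_eq)
    hence "2 ^ j * real h \<le> real_of_int p" by simp
    moreover have "(2::real) ^ j * 1 \<le> 2 ^ j * real h" using h by (intro mult_left_mono) auto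
    moreover have "2 powr real j = (2::real) ^ j" by (simp add: powr_realpow)
    ultimately have "2 powr real j \<le> real_of_int p" by linarith
    hence "real j \<le> log 2 (real_of_int p)" using p_pos by (subst le_log_iff) auto
    thus "j \<in> {..nat \<lfloor>log 2 (real_of_int p)\<rfloor>}" by (simp add: le_nat_floor)
  qed
  hence finS: "finite S" by (rule finite_subset) simp
  have "real (card S) \<le> real (card {..nat \<lfloor>log 2 (real_of_int p)\<rfloor>})"
    by (intro of_nat_mono card_mono S) simp
  also have "\<dots> \<le> 1 + log 2 (real_of_int p)" using gt2 by simp
  finally have cardS: "real (card S) \<le> 1 + log 2 (real_of_int p)" .
  let ?G = "\<lambda>y. cmod (weighted_sum \<alpha> M y)" and ?\<Phi> = "\<lambda>y. cmod (\<Sum>n\<in>J. e (n * y))"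
  have "cmod (\<Sum>m\<in>M. \<Sum>n\<in>J. \<alpha> m * kloosterman p m n) \<le> (\<Sum>y\<in>centred. ?G y * ?\<Phi> y)"
    unfolding bilinear_sum_eq by (intro sum_norm_le) (simp add: norm_mult)
  also have "\<dots> \<le> (\<Sum>y\<in>centred. \<Sum>j\<in>S. if \<bar>y\<bar> \<le> int (2 ^ j * h) then 2 * real N / 2 ^ j * ?G y else 0)"
  proof (rule sum_mono)
    fix y assume y: "y \<in> centred"
    obtain j where j: "int (2 ^ j * h) \<le> p" "\<bar>y\<bar> \<le> int (2 ^ j * h)" "?\<Phi> y \<le> 2 * real N / 2 ^ j"
      by (rule obtain_dyadic_scale[OF J N y h])
    have "?G y * ?\<Phi> y \<le> 2 * real N / 2 ^ j * ?G y"
      using j(3) by (subst mult.commute) (intro mult_right_mono; simp)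
    also have "\<dots> = (\<Sum>j\<in>{j}. if \<bar>y\<bar> \<le> int (2 ^ j * h) then 2 * real N / 2 ^ j * ?G y else 0)"
      using j(2) by simp
    also have "\<dots> \<le> (\<Sum>j\<in>S. if \<bar>y\<bar> \<le> int (2 ^ j * h) then 2 * real N / 2 ^ j * ?G y else 0)"
      using j(1) finS by (intro sum_mono2) (auto simp: S_def)
    finally show "?G y * ?\<Phi> y \<le> \<dots>" .
  qed
  also have "\<dots> = (\<Sum>j\<in>S. \<Sum>y\<in>centred. if \<bar>y\<bar> \<le> int (2 ^ j * h) then 2 * real N / 2 ^ j * ?G y else 0)"
    by (rule sum.swap)
  also have "\<dots> \<le> (\<Sum>j\<in>S. 2 * real N * real h * D)"
  proof (rule sum_mono)
    fix j assume j: "j \<in> S"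
    have "(\<Sum>y\<in>centred. if \<bar>y\<bar> \<le> int (2 ^ j * h) then 2 * real N / 2 ^ j * ?G y else 0)
      = (\<Sum>y\<in>{y\<in>centred. \<bar>y\<bar> \<le> int (2 ^ j * h)}. 2 * real N / 2 ^ j * ?G y)"
      by (rule sum.inter_filter[symmetric, OF finite_centred])
    also have "\<dots> \<le> (\<Sum>y\<in>{- int (2 ^ j * h)..int (2 ^ j * h)}. 2 * real N / 2 ^ j * ?G y)"
      by (intro sum_mono2) (auto simp: abs_le_iff)
    also have "\<dots> = 2 * real N / 2 ^ j * (\<Sum>y\<in>{- int (2 ^ j * h)..int (2 ^ j * h)}. ?G y)"
      by (rule sum_distrib_left[symmetric])
    also have "\<dots> \<le> 2 * real N / 2 ^ j * (real (2 ^ j * h) * D)"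
      using j by (intro mult_left_mono D) (auto simp: S_def)
    also have "\<dots> = 2 * real N * real h * D" by simp
    finally show "(\<Sum>y\<in>centred. if \<bar>y\<bar> \<le> int (2 ^ j * h) then 2 * real N / 2 ^ j * ?G y else 0) \<le> 2 * real N * real h * D" .
  qed
  also have "\<dots> = real (card S) * (2 * real N * real h * D)" by simp
  also have "\<dots> \<le> (1 + log 2 (real_of_int p)) * (2 * real N * real h * D)"
    using cardS D0 by (intro mult_right_mono) auto
  finally show ?thesis .
qed

end

section \<open>Arithmetic of the exponents\<close>

lemma powr_add_le_add_powr:
  fixes x y a :: real
  assumes "x \<ge> 0" "y \<ge> 0" "0 < a" "a \<le> 1"
  shows "(x + y) powr a \<le> x powr a + y powr a"
proof (cases "x + y = 0")
  case True
  thus ?thesis using assms by simp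
next
  case False
  hence s: "x + y > 0" using assms by simp
  have le: "t \<le> t powr a" if "0 \<le> t" "t \<le> 1" for t :: real
    using powr_mono'[of a 1 t] that assms by (cases "t = 0") auto
  have "x / (x + y) \<le> (x / (x + y)) powr a" "y / (x + y) \<le> (y / (x + y)) powr a"
    using assms s by (intro le; simp)+
  moreover have "x / (x + y) + y / (x + y) = 1" using s by (simp flip: add_divide_distrib)
  ultimately have "1 \<le> x powr a / (x + y) powr a + y powr a / (x + y) powr a"
    using assms s by (simp add: powr_divide)
  thus ?thesis using s by (simp add: field_simps flip: add_divide_distrib)
qed

text \<open>Multiplied by M N p^(1/2), each term of the claim takes the shape in which the proof
  produces it: the trivial bound mq times a saving to the power 1/(4r), or the diagonal q m^(1/2).
  In logarithms all three identities are linear.\<close>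

lemma powr_identities:
  fixes m n q r :: real
  assumes "m > 0" "n > 0" "q > 0" "r > 0"
  shows "m * n * q powr (1/2) * (q powr (1/2) / (m powr (1/2) * n)) = q * m powr (1/2)"
    and "m * n * q powr (1/2) * (q powr (1/2 - 1 / (4 * r)) / n powr (1 - 1 / (4 * r)))
      = m * q * (n / q) powr (1 / (4 * r))"
    and "m * n * q powr (1/2) * (q powr (1/2 - (r - 1) / (4 * r\<^sup>2)) / (m powr (5 / (26 * r)) * n powr (1 - 1 / (2 * r))))
      = m * q * (q powr (1 / r - 1) * n\<^sup>2 * m powr (- (10/13))) powr (1 / (4 * r))"
proof -
  define x y z where "x = ln m" and "y = ln n" and "z = ln q"
  have e: "m = exp x" "n = exp y" "q = exp z" using assms by (simp_all add: x_def y_def z_def)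
  have p: "exp u powr a = exp (a * u)" for u a :: real by (simp add: powr_def)
  note simps = e p exp_add[symmetric] exp_diff[symmetric] exp_double[symmetric]
  show "m * n * q powr (1/2) * (q powr (1/2) / (m powr (1/2) * n)) = q * m powr (1/2)"
    by (simp only: simps exp_inj_iff)
  show "m * n * q powr (1/2) * (q powr (1/2 - 1 / (4 * r)) / n powr (1 - 1 / (4 * r)))
      = m * q * (n / q) powr (1 / (4 * r))"
    by (simp only: simps exp_inj_iff) (use assms in \<open>simp add: field_simps\<close>)
  show "m * n * q powr (1/2) * (q powr (1/2 - (r - 1) / (4 * r\<^sup>2)) / (m powr (5 / (26 * r)) * n powr (1 - 1 / (2 * r))))
      = m * q * (q powr (1 / r - 1) * n\<^sup>2 * m powr (- (10/13))) powr (1 / (4 * r))"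
    by (simp only: simps exp_inj_iff) (use assms in \<open>simp add: field_simps power2_eq_square\<close>)
qed

text \<open>For \<open>r \<ge> 2\<close> one has 4r - 1 \<le> 7(r - 1), so the last hypothesis gives
  q \<le> n^7. With m \<le> q^(1/2) this yields m^(7/26) \<le> n^(49/52).\<close>

lemma powr_le_of_power_gt:
  fixes m n q :: real
  assumes "r \<ge> 2" "m \<ge> 1" "n \<ge> 1" "q > 1" "m \<le> q powr (1/2)" "q ^ (r - 1) < n ^ (4 * r - 1)"
  shows "m powr (7/26) \<le> n"
proof -
  define x y z where "x = ln m" and "y = ln n" and "z = ln q"
  have xyz: "x \<ge> 0" "y \<ge> 0" "z > 0" using assms by (simp_all add: x_def y_def z_def)
  have "ln m \<le> ln (q powr (1/2))" using assms by (subst ln_le_cancel_iff) auto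
  hence x: "x \<le> z / 2" using assms by (simp add: x_def z_def ln_powr)
  have "ln (q ^ (r - 1)) < ln (n ^ (4 * r - 1))" using assms by (subst ln_less_cancel_iff) auto
  hence lt: "(real r - 1) * z < (4 * real r - 1) * y"
    using assms by (simp add: z_def y_def ln_realpow of_nat_diff)
  have "(4 * real r - 1) * z \<le> 7 * ((real r - 1) * z)"
    using assms xyz by (simp add: algebra_simps)
  hence "(4 * real r - 1) * z \<le> (4 * real r - 1) * (7 * y)" using lt by linarith
  hence "z \<le> 7 * y" using assms by (subst (asm) mult_le_cancel_left_pos) auto
  hence "7/26 * x \<le> y" using x xyz by linarith
  hence "exp (7/26 * x) \<le> exp y" by simp
  thus ?thesis using assms by (simp add: x_def y_def powr_def)
qed

section \<open>Short and long intervals\<close>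

context odd_prime
begin

lemma small_interval_bound:
  assumes M: "M \<subseteq> {0..<p}" and c: "\<And>m. m \<in> M \<Longrightarrow> cmod (\<alpha> m) \<le> c" and c0: "c \<ge> 0"
    and J: "J \<subseteq> {1..<p}" "is_residue_interval p N J"
  shows "cmod (\<Sum>m\<in>M. \<Sum>n\<in>J. \<alpha> m * kloosterman p m n)
    \<le> 2 * c * (real (card M) * real N * real_of_int p powr (3/4))"
proof -
  have K: "cmod (kloosterman p m n) \<le> 2 * real_of_int p powr (3/4)" if "n \<in> J" for m n
  proof -
    have "\<not> p dvd n" using that J(1) by (intro not_dvd_unit) auto
    hence "cmod (kloosterman p m n) ^ 4 \<le> 3 * real_of_int p ^ 3" by (rule norm_kloosterman_le)
    also have "\<dots> \<le> 2 ^ 4 * real_of_int p ^ 3" using p_pos by simp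
    also have "\<dots> = (2 * real_of_int p powr (3/4)) ^ 4"
      using p_pos by (simp add: power_mult_distrib powr_power)
    finally show ?thesis by (rule power_le_imp_le_base[where n = 3, simplified]) simp
  qed
  obtain N0 where "J = (\<lambda>k. k mod p) ` {N0 + 1..N0 + int N}"
    using J(2) by (auto simp: is_residue_interval_def)
  hence "card J \<le> card {N0 + 1..N0 + int N}" by (simp only: card_image_le finite_atLeastAtMost_int)
  hence cardJ: "card J \<le> N" by simp
  have "cmod (\<Sum>m\<in>M. \<Sum>n\<in>J. \<alpha> m * kloosterman p m n) \<le> (\<Sum>m\<in>M. \<Sum>n\<in>J. c * (2 * real_of_int p powr (3/4)))"
  proof (intro sum_norm_le)
    fix m n assume "m \<in> M" "n \<in> J"
    thus "cmod (\<alpha> m * kloosterman p m n) \<le> c * (2 * real_of_int p powr (3/4))"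
      unfolding norm_mult using c0 by (intro mult_mono c K) auto
  qed
  also have "\<dots> = 2 * c * (real (card M) * real (card J) * real_of_int p powr (3/4))" by simp
  also have "\<dots> \<le> 2 * c * (real (card M) * real N * real_of_int p powr (3/4))"
    using c0 cardJ by (intro mult_left_mono mult_right_mono) auto
  finally show ?thesis .
qed

lemma large_interval_bound:
  fixes r N :: nat
  assumes M: "M \<subseteq> {0..<p}" and m1: "card M \<ge> 1" and c: "\<And>m. m \<in> M \<Longrightarrow> cmod (\<alpha> m) \<le> c" and c0: "c \<ge> 0"
    and J: "is_residue_interval p N J"
    and r: "r \<ge> 2" "int r < p" "2 ^ r \<le> real_of_int p"
    and N: "N \<ge> 1" "real N \<le> real_of_int p powr (1 - 1 / real r)" "real (card M) powr (7/26) \<le> real N"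
  defines "m \<equiv> real (card M)" and "q \<equiv> real_of_int p" and "K \<equiv> 1024 * (real (2 * r) ^ r + 4 * real r)"
  shows "cmod (\<Sum>m\<in>M. \<Sum>n\<in>J. \<alpha> m * kloosterman p m n)
    \<le> 128 * K * ((1 + log 2 q) * (1 + ln q)) * c *
      (q * m powr (1/2) + m * q * (1 / q) powr (1 / (4 * real r))
       + m * q * (q powr (1 / real r - 1) * (real N)\<^sup>2 * m powr (- (10/13))) powr (1 / (4 * real r)))"
proof -
  \<comment> \<open>The kernel bound min(N, p/|y|) changes regime at p/N; rounding up keeps N h
    between q and 2q.\<close>
  define h where "h = nat \<lceil>q / real N\<rceil>"
  \<comment> \<open>This size balances the two terms of \<open>reciprocal_moment\<close>. Since
    \<open>2 ^ r \<le> p\<close>, \<open>B\<close> is at least 2 and 2B still exceeds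
    q^(1/r).\<close>
  define B where "B = nat \<lfloor>q powr (1 / real r)\<rfloor>"
  define t where "t = q powr (1 / real r - 1) * (real N)\<^sup>2 * m powr (- (10/13))"
  \<comment> \<open>\<open>4 * t\<close> collects two terms of the coincidence bound, each shown to
    be at most \<open>2 * t\<close>. The result does not depend on X, as the dyadic summation
    requires.\<close>
  define D where "D = 4 * c * (sqrt m + m * (K * (2 * (1 + ln q)) * (1 / q + 4 * t)) powr (1 / (4 * real r)))"
  have q: "q > 2" using gt2 by (simp add: q_def)
  have m: "m \<ge> 1" using m1 by (simp add: m_def)
  have t0: "t > 0" using q m N by (simp add: t_def)
  have K: "K \<ge> 1"
  proof -
    have linear: "1 \<le> 1024 * (x + 4 * y)" if "0 \<le> x" "1 \<le> y" for x y :: real using that by simp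
    show ?thesis unfolding K_def by (rule linear) (use r in simp_all)
  qed
  have lnq: "ln q \<ge> 0" using q by simp
  have D0: "D \<ge> 0" using c0 m by (simp add: D_def)
  have Nq: "real N \<le> q"
  proof -
    have "q powr (1 - 1 / real r) \<le> q powr 1" using q by (intro powr_mono) auto
    thus ?thesis using N(2) q by (simp add: q_def)
  qed
  have h: "h \<ge> 1" "q \<le> real N * real h" "int h \<le> p" "real N * real h \<le> 2 * q"
  proof -
    have pos: "q / real N > 0" using q N by simp
    hence hc: "int h = \<lceil>q / real N\<rceil>" by (simp add: h_def)
    show "h \<ge> 1" using pos by (simp add: h_def Suc_le_eq)
    have ge: "q / real N \<le> real h" using hc by (metis le_of_int_ceiling of_int_of_nat_eq)
    thus "q \<le> real N * real h" using N by (simp add: field_simps)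
    have "q / real N \<le> q" using N q by (simp add: field_simps)
    thus "int h \<le> p" unfolding hc ceiling_le_iff by (simp add: q_def)
    have "real h \<le> q / real N + 1" using hc by linarith
    hence "real N * real h \<le> real N * (q / real N + 1)" by (intro mult_left_mono) auto
    also have "\<dots> = q + real N" using N by (simp add: field_simps)
    finally show "real N * real h \<le> 2 * q" using Nq by simp
  qed
  have B: "B \<ge> 2" "real B \<le> q powr (1 / real r)" "int B < p" "q \<le> (2 * real B) ^ r"
  proof -
    have root: "(q powr (1 / real r)) ^ r = q"
      using q r by (simp add: powr_power)
    have ge2: "2 \<le> q powr (1 / real r)"
    proof (rule ccontr)
      assume "\<not> 2 \<le> q powr (1 / real r)"
      hence "(q powr (1 / real r)) ^ r < 2 ^ r" using r by (intro power_strict_mono) auto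
      thus False using root r by (simp add: q_def)
    qed
    thus "B \<ge> 2" by (simp add: B_def le_nat_iff le_floor_iff)
    show Bq: "real B \<le> q powr (1 / real r)" using ge2 by (simp add: B_def)
    have "q powr (1 / real r) < q powr 1" using q r by (intro powr_less_mono) auto
    hence "real B < real_of_int p" using Bq q by (simp add: q_def)
    thus "int B < p" by linarith
    have "q powr (1 / real r) \<le> real B + 1" unfolding B_def by linarith
    also have "\<dots> \<le> 2 * real B" using \<open>B \<ge> 2\<close> by simp
    finally have "(q powr (1 / real r)) ^ r \<le> (2 * real B) ^ r" by (intro power_mono) auto
    thus "q \<le> (2 * real B) ^ r" by (simp only: root)
  qed
  have sumG: "(\<Sum>y\<in>{- int X..int X}. cmod (weighted_sum \<alpha> M y)) \<le> real X * D" if X: "h \<le> X" "int X \<le> p" for X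
  proof -
    define A where "A = X div B"
    define x where "x = real X"
    have qx: "q / real N \<le> x"
    proof -
      have "real N * real h \<le> real N * x" using X by (intro mult_left_mono) (auto simp: x_def)
      hence "q \<le> x * real N" using h(2) by (simp add: mult.commute[of x])
      thus ?thesis using N(1) by (simp add: pos_divide_le_eq)
    qed
    have x0: "x > 0" using qx q N by (smt (verit) divide_pos_pos of_nat_0_less_iff less_le_trans zero_less_one Suc_le_eq One_nat_def)
    \<comment> \<open>Here N \<le> p^(1-1/r) is used: it gives B \<le> p/N \<le> X, so that
      \<open>X div B\<close> is positive.\<close>
    have "q powr (1 / real r) * real N \<le> q powr (1 / real r) * q powr (1 - 1 / real r)"
      using N by (intro mult_left_mono) (auto simp: q_def)
    also have "\<dots> = q" using q by (simp flip: powr_add)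
    finally have "q powr (1 / real r) \<le> q / real N" using N by (simp add: field_simps)
    hence "real B \<le> x" using B(2) qx by linarith
    hence "B \<le> X" by (simp add: x_def)
    hence A1: "A \<ge> 1" using B(1) by (simp add: A_def Suc_le_eq div_greater_zero_iff)
    have AB: "A * B \<le> X" by (simp add: A_def)
    \<comment> \<open>As \<open>B \<ge> 2\<close>, A is at most X/2 and so below \<open>p\<close>;
      every a up to A is then invertible.\<close>
    have "A * 2 \<le> A * B" using B(1) by (rule mult_le_mono2)
    hence "A * 2 \<le> X" using AB by linarith
    hence Ap: "int A < p" using X(2) A1 by linarith
    have "X < A * B + B" using B(1) by (simp add: A_def div_mult_mod_eq[symmetric] dividend_less_div_times add.commute)
    also have "\<dots> \<le> 2 * (A * B)" using A1 by simp
    finally have "real X < real (2 * (A * B))" by (simp only: of_nat_less_iff)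
    hence Ax: "x \<le> 2 * real A * real B" by (simp add: x_def)
    have a: "1 / real A \<le> 2 * real B / x"
      using Ax A1 x0 by (simp add: field_simps)
    have inv_x: "1 / x \<le> real N / q" using qx x0 N q by (simp add: field_simps)
    have m_pow: "m powr (- 1) \<le> m powr (- (10/13))" using m by (intro powr_mono) auto
    \<comment> \<open>The only use of m^(7/26) \<le> N, through 7/26 - 10/13 = -1/2: it trades one
      factor N for the missing power of m.\<close>
    have N_sq: "real N * m powr (- (1/2)) \<le> (real N)\<^sup>2 * m powr (- (10/13))"
    proof -
      have "m powr (7/26) * m powr (- (10/13)) = m powr (- (1/2))" by (simp flip: powr_add)
      hence "real N * m powr (- (1/2)) = real N * m powr (7/26) * m powr (- (10/13))" by simp
      also have "\<dots> \<le> real N * real N * m powr (- (10/13))"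
        using N(3) by (intro mult_right_mono mult_left_mono) (auto simp: m_def)
      finally show ?thesis by (simp add: power2_eq_square)
    qed
    have t_eq: "q powr (1 / real r) * (real N)\<^sup>2 * m powr (- (10/13)) / q = t"
      using q by (simp add: t_def powr_diff)
    have "1 / (real A * sqrt m) = 1 / real A * m powr (- (1/2))"
      using m by (simp add: powr_minus powr_half_sqrt field_simps)
    also have "\<dots> \<le> 2 * real B * (1 / x) * m powr (- (1/2))"
      using a by (intro mult_right_mono) auto
    also have "\<dots> \<le> 2 * q powr (1 / real r) * (real N / q) * m powr (- (1/2))"
      using B(2) inv_x x0 by (intro mult_right_mono mult_mono) auto
    also have "\<dots> = 2 * q powr (1 / real r) / q * (real N * m powr (- (1/2)))" by simp
    also have "\<dots> \<le> 2 * q powr (1 / real r) / q * ((real N)\<^sup>2 * m powr (- (10/13)))"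
      using N_sq q by (intro mult_left_mono) auto
    also have "\<dots> = 2 * t" using t_eq by simp
    finally have t1: "1 / (real A * sqrt m) \<le> 2 * t" .
    have "q / (real A * real X * m) = q * (1 / real A) * (1 / x) * m powr (- 1)"
      using m by (simp add: powr_minus field_simps x_def)
    also have "\<dots> \<le> q * (2 * real B / x) * (1 / x) * m powr (- 1)"
      using a q x0 by (intro mult_right_mono mult_left_mono) auto
    also have "\<dots> = 2 * q * real B * ((1 / x) * (1 / x)) * m powr (- 1)" by simp
    also have "\<dots> \<le> 2 * q * q powr (1 / real r) * ((real N / q) * (real N / q)) * m powr (- (10/13))"
      using B(2) inv_x x0 q m_pow by (intro mult_mono) auto
    also have "\<dots> = 2 * (q powr (1 / real r) * (real N)\<^sup>2 * m powr (- (10/13)) / q)"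
      using q by (simp add: power2_eq_square)
    also have "\<dots> = 2 * t" by (simp only: t_eq)
    finally have t2: "q / (real A * real X * m) \<le> 2 * t" .
    have "(\<Sum>y\<in>{- int X..int X}. cmod (weighted_sum \<alpha> M y))
      \<le> 4 * c * real X * (sqrt m + m *
      (K * (2 * (1 + ln q)) * (1 / q + 1 / (real A * sqrt m) + q / (real A * real X * m))) powr (1 / (4 * real r)))"
      unfolding m_def q_def K_def
      by (rule sum_norm_weighted_sum_le[OF M m1 c A1 Ap AB _ B(3)]) (use B(1,4) r in \<open>auto simp: q_def\<close>)
    also have "\<dots> \<le> 4 * c * real X * (sqrt m + m * (K * (2 * (1 + ln q)) * (1 / q + 4 * t)) powr (1 / (4 * real r)))"
      using t1 t2 c0 m q K lnq A1
      by (intro mult_left_mono add_left_mono powr_mono2 mult_nonneg_nonneg) auto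
    also have "\<dots> = real X * D" by (simp add: D_def)
    finally show ?thesis .
  qed
  have D_le: "D \<le> 4 * c * (8 * K * (1 + ln q) * (m powr (1/2) + m * ((1 / q) powr (1 / (4 * real r)) + t powr (1 / (4 * real r)))))"
  proof -
    define a where "a = 1 / (4 * real r)"
    define E where "E = 8 * K * (1 + ln q)"
    have a: "0 < a" "a \<le> 1" using r by (auto simp: a_def field_simps)
    have E: "E \<ge> 1" using K lnq mult_mono[of 1 K 1 "1 + ln q"] by (simp add: E_def)
    have "(K * (2 * (1 + ln q)) * (1 / q + 4 * t)) powr a \<le> (E * (1 / q + t)) powr a"
    proof (rule powr_mono2)
      have "K * (2 * (1 + ln q)) * (1 / q + 4 * t) \<le> K * (2 * (1 + ln q)) * (4 * (1 / q + t))"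
        using K lnq q by (intro mult_left_mono mult_nonneg_nonneg) (auto intro!: divide_right_mono)
      also have "\<dots> = E * (1 / q + t)" by (simp add: E_def algebra_simps)
      finally show "K * (2 * (1 + ln q)) * (1 / q + 4 * t) \<le> E * (1 / q + t)" .
    qed (use K lnq q t0 a in auto)
    also have "\<dots> = E powr a * (1 / q + t) powr a" using E q t0 by (intro powr_mult)
    also have "\<dots> \<le> E powr 1 * ((1 / q) powr a + t powr a)"
      using E q t0 a by (intro mult_mono powr_mono powr_add_le_add_powr) auto
    finally have "(K * (2 * (1 + ln q)) * (1 / q + 4 * t)) powr a \<le> E * ((1 / q) powr a + t powr a)"
      using E by simp
    hence "m * (K * (2 * (1 + ln q)) * (1 / q + 4 * t)) powr a \<le> m * (E * ((1 / q) powr a + t powr a))"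
      using m by (intro mult_left_mono) auto
    moreover have "sqrt m \<le> E * m powr (1/2)" using E m mult_right_mono[of 1 E "sqrt m"] by (simp add: powr_half_sqrt)
    ultimately have "sqrt m + m * (K * (2 * (1 + ln q)) * (1 / q + 4 * t)) powr a
        \<le> E * (m powr (1/2) + m * ((1 / q) powr a + t powr a))"
      by (simp add: algebra_simps)
    thus ?thesis unfolding D_def a_def[symmetric] E_def[symmetric] using c0 by (intro mult_left_mono) auto
  qed
  have "cmod (\<Sum>m\<in>M. \<Sum>n\<in>J. \<alpha> m * kloosterman p m n) \<le> (1 + log 2 q) * (2 * real N * real h * D)"
    unfolding q_def using h Nq by (intro bilinear_sum_dyadic_le[OF J N(1)] sumG D0) (auto simp: q_def)
  also have "\<dots> = (1 + log 2 q) * (2 * (real N * real h) * D)" by simp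
  also have "\<dots> \<le> (1 + log 2 q) * (2 * (2 * q) * (4 * c * (8 * K * (1 + ln q) * (m powr (1/2) + m * ((1 / q) powr (1 / (4 * real r)) + t powr (1 / (4 * real r)))))))"
    by (intro mult_left_mono[OF mult_mono[OF _ D_le]]) (use h(4) D0 q in auto)
  \<comment> \<open>128 = 2 * 2 * 4 * 8: the kernel bound 2N/2^j, the rounding N h \<le> 2q, the
    constant of the mean bound and the 8 in \<open>D_le\<close>.\<close>
  also have "\<dots> = 128 * K * ((1 + log 2 q) * (1 + ln q)) * c *
      (q * m powr (1/2) + m * q * (1 / q) powr (1 / (4 * real r)) + m * q * t powr (1 / (4 * real r)))"
    by (simp add: algebra_simps)
  finally show ?thesis by (simp only: t_def)
qed

end

theorem theorem2p8:
  fixes r :: nat and \<epsilon> :: real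
  assumes "r \<ge> 1" and "\<epsilon> > 0"
  shows "\<exists>C::real. C > 0 \<and> (\<exists>p0::int. \<forall>p::int. prime p \<and> p \<ge> p0 \<longrightarrow>
    (\<forall>(\<M>::int set) (\<J>::int set) (M::nat) (N::nat) (\<alpha>::int \<Rightarrow> complex).
      \<M> \<subseteq> {0..<p} \<and> card \<M> = M \<and> 1 \<le> M \<and> real M \<le> real_of_int p powr (1 / 2) \<and>
      \<J> \<subseteq> {1..<p} \<and> is_residue_interval p N \<J> \<and>
      1 \<le> N \<and> real N \<le> real_of_int p powr (1 - 1 / real r) \<longrightarrow>
      cmod (\<Sum>m\<in>\<M>. \<Sum>n\<in>\<J>. \<alpha> m * kloosterman p m n)
        \<le> C * max_norm \<M> \<alpha> * real M * real N * real_of_int p powr (1 / 2 + \<epsilon>) *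
          (real_of_int p powr (1 / 2) / (real M powr (1 / 2) * real N)
           + real_of_int p powr (1 / 2 - 1 / (4 * real r)) / real N powr (1 - 1 / (4 * real r))
           + real_of_int p powr (1 / 2 - (real r - 1) / (4 * (real r)\<^sup>2))
               / (real M powr (5 / (26 * real r)) * real N powr (1 - 1 / (2 * real r))))))"
proof -
  define K where "K = 1024 * (real (2 * r) ^ r + 4 * real r)"
  have K: "K \<ge> 1"
  proof -
    have linear: "1 \<le> 1024 * (x + 4 * y)" if "0 \<le> x" "1 \<le> y" for x y :: real using that by simp
    show ?thesis unfolding K_def by (rule linear) (use assms in simp_all)
  qed
  \<comment> \<open>Two logarithms are lost, one from the number of dyadic scales and one from the
    sum over heights; both go into p^\<epsilon>.\<close>
  have "((\<lambda>q. (1 + log 2 q) * (1 + ln q) / q powr \<epsilon>) \<longlongrightarrow> 0) at_top"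
    using assms(2) by real_asymp
  hence "eventually (\<lambda>q. (1 + log 2 q) * (1 + ln q) / q powr \<epsilon> < 1) at_top"
    by (rule order_tendstoD) simp
  then obtain q0 where q0: "\<And>q. q \<ge> q0 \<Longrightarrow> (1 + log 2 q) * (1 + ln q) / q powr \<epsilon> < 1"
    by (auto simp: eventually_at_top_linorder)
  define p0 where "p0 = max (max 3 \<lceil>q0\<rceil>) (max (int r + 1) (2 ^ r))"
  show ?thesis
  proof (intro exI[of _ "128 * K"] exI[of _ p0] conjI allI impI)
    show "128 * K > 0" using K by simp
    fix p :: int and \<M> \<J> :: "int set" and M N :: nat and \<alpha> :: "int \<Rightarrow> complex"
    assume p: "prime p \<and> p \<ge> p0"
    assume *: "\<M> \<subseteq> {0..<p} \<and> card \<M> = M \<and> 1 \<le> M \<and> real M \<le> real_of_int p powr (1 / 2) \<and>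
      \<J> \<subseteq> {1..<p} \<and> is_residue_interval p N \<J> \<and>
      1 \<le> N \<and> real N \<le> real_of_int p powr (1 - 1 / real r)"
    define q where "q = real_of_int p"
    define c where "c = max_norm \<M> \<alpha>"
    define m n where "m = real M" and "n = real N"
    define a where "a = 1 / (4 * real r)"
    define t where "t = q powr (1 / real r - 1) * n\<^sup>2 * m powr (- (10/13))"
    have p': "p > 2" "int r < p" "2 ^ r \<le> p" "\<lceil>q0\<rceil> \<le> p" using p by (auto simp: p0_def)
    interpret odd_prime p by unfold_locales (use p p' in auto)
    have q: "q > 2" "q \<ge> q0" using p' by (simp_all add: q_def ceiling_le_iff)
    have mn: "m \<ge> 1" "n \<ge> 1" using * by (auto simp: m_def n_def)
    have fin: "finite \<M>" using * by (auto intro: card_ge_0_finite)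
    have ne: "\<M> \<noteq> {}" using * by auto
    have c: "cmod (\<alpha> k) \<le> c" if "k \<in> \<M>" for k
      unfolding c_def max_norm_def using fin that by (intro Max_ge) auto
    have c0: "c \<ge> 0" using ne c norm_ge_zero order_trans by blast
    have main: "cmod (\<Sum>m\<in>\<M>. \<Sum>n\<in>\<J>. \<alpha> m * kloosterman p m n) \<le> 128 * K * q powr \<epsilon> * c *
      (q * m powr (1/2) + m * q * (n / q) powr a + m * q * t powr a)"
    \<comment> \<open>Raising n q^(3/4) \<le> q (n/q)^(1/(4r)) to the power 4r gives exactly this
      inequality.\<close>
    proof (cases "n ^ (4 * r - 1) \<le> q ^ (r - 1)")
      case True
      have "n * q powr (3/4) \<le> q * (n / q) powr a"
      proof -
        define y z where "y = ln n" and "z = ln q"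
        have e: "n = exp y" "q = exp z" using mn q by (simp_all add: y_def z_def)
        have "ln (n ^ (4 * r - 1)) \<le> ln (q ^ (r - 1))" using True mn q by (subst ln_le_cancel_iff) auto
        hence "(4 * real r - 1) * y \<le> (real r - 1) * z"
          using assms(1) mn q by (simp add: y_def z_def ln_realpow of_nat_diff)
        hence "y + 3/4 * z \<le> z + a * (y - z)"
          using assms(1) by (simp add: a_def field_simps)
        hence "exp (y + 3/4 * z) \<le> exp (z + a * (y - z))" by simp
        thus ?thesis by (simp add: e powr_def exp_add exp_diff[symmetric])
      qed
      hence le: "m * n * q powr (3/4) \<le> m * q * (n / q) powr a" using mn by (simp add: mult.assoc)
      have "cmod (\<Sum>m\<in>\<M>. \<Sum>n\<in>\<J>. \<alpha> m * kloosterman p m n) \<le> 2 * c * (m * n * q powr (3/4))"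
        using small_interval_bound[of \<M> \<alpha> c \<J> N] * c c0 by (simp add: m_def n_def q_def)
      also have "\<dots> \<le> 2 * c * (m * q * (n / q) powr a)"
        using le c0 by (intro mult_left_mono) auto
      also have "\<dots> \<le> (128 * K * q powr \<epsilon>) * c * (m * q * (n / q) powr a)"
      proof -
        have "1 \<le> K * q powr \<epsilon>" using mult_mono[of 1 K 1 "q powr \<epsilon>"] K q assms(2) by (simp add: ge_one_powr_ge_zero)
        thus ?thesis using c0 mn q by (intro mult_right_mono) auto
      qed
      also have "\<dots> \<le> (128 * K * q powr \<epsilon>) * c * (q * m powr (1/2) + m * q * (n / q) powr a + m * q * t powr a)"
        using c0 mn q K by (intro mult_left_mono) auto
      finally show ?thesis by simp
    next
      case False
      have r2: "r \<ge> 2"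
      proof (rule ccontr)
        assume "\<not> r \<ge> 2"
        \<comment> \<open>For r = 1 the length is at most p^0 = 1, and the threshold inequality
          reads 1 \<le> 1; this case belongs to the short range.\<close>
        hence "r = 1" using assms(1) by simp
        hence "n \<le> 1" using * q by (simp add: n_def q_def)
        thus False using False mn \<open>r = 1\<close> by simp
      qed
      have m_le: "m powr (7/26) \<le> n"
        using False * q mn r2 by (intro powr_le_of_power_gt[of r m n q]) (auto simp: m_def q_def)
      have "2 ^ r \<le> real_of_int p" using p'(3) by (metis of_int_le_iff of_int_numeral of_int_power)
      hence "cmod (\<Sum>m\<in>\<M>. \<Sum>n\<in>\<J>. \<alpha> m * kloosterman p m n) \<le> 128 * K * ((1 + log 2 q) * (1 + ln q)) * c *
        (q * m powr (1/2) + m * q * (1 / q) powr a + m * q * t powr a)"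
        unfolding K_def t_def a_def m_def n_def q_def
        using large_interval_bound[of \<M> \<alpha> c N \<J> r] * c c0 r2 p' m_le by (simp add: m_def n_def)
      \<comment> \<open>The equidistribution term 1/q of the coincidence count is smaller than the
        n/q that the claim allows.\<close>
      also have "\<dots> \<le> 128 * K * q powr \<epsilon> * c * (q * m powr (1/2) + m * q * (n / q) powr a + m * q * t powr a)"
      proof (intro mult_mono add_mono order_refl powr_mono2)
        show "(1 + log 2 q) * (1 + ln q) \<le> q powr \<epsilon>" using q0[OF q(2)] q by (simp add: field_simps)
      qed (use K c0 q mn in \<open>auto simp: a_def divide_right_mono\<close>)
      finally show ?thesis .
    qed
    also have "128 * K * q powr \<epsilon> * c * (q * m powr (1/2) + m * q * (n / q) powr a + m * q * t powr a)
      = 128 * K * c * m * n * q powr (1/2 + \<epsilon>) *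
          (q powr (1/2) / (m powr (1/2) * n) + q powr (1/2 - 1 / (4 * real r)) / n powr (1 - 1 / (4 * real r))
           + q powr (1/2 - (real r - 1) / (4 * (real r)\<^sup>2)) / (m powr (5 / (26 * real r)) * n powr (1 - 1 / (2 * real r))))"
    proof -
      have pos: "m > 0" "n > 0" "q > 0" "real r > 0" using mn q assms(1) by auto
      show ?thesis
        unfolding a_def t_def powr_identities[OF pos, symmetric] powr_add
        by (simp only: distrib_left mult_ac)
    qed
    finally show "cmod (\<Sum>m\<in>\<M>. \<Sum>n\<in>\<J>. \<alpha> m * kloosterman p m n)
        \<le> 128 * K * max_norm \<M> \<alpha> * real M * real N * real_of_int p powr (1 / 2 + \<epsilon>) *
          (real_of_int p powr (1 / 2) / (real M powr (1 / 2) * real N)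
           + real_of_int p powr (1 / 2 - 1 / (4 * real r)) / real N powr (1 - 1 / (4 * real r))
           + real_of_int p powr (1 / 2 - (real r - 1) / (4 * (real r)\<^sup>2))
               / (real M powr (5 / (26 * real r)) * real N powr (1 - 1 / (2 * real r))))"
      by (simp only: c_def m_def n_def q_def)
  qed
qed

end
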